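(* Let $\alpha,\beta,\lambda\in(0,1)$ with $\kappa:=\alpha+\beta+\lambda<1$, and for a function $f$ on $(0,\infty)$ let $$U_{\alpha,\beta,\lambda}[f](x)=x^{-\beta}\int_0^x \frac{y^{-\alpha} f(y)\,dy}{|x-y|^{\lambda}},\qquad x\in(0,\infty).$$ Let $p_-=\frac{1}{1-\alpha}$, $p_+=\frac{1}{1-\alpha-\lambda}$; for $p\in(p_-,p_+)$ let $q=q(p)$ be defined by $1+\frac1q=\frac1p+\kappa$, with inverse function $p=p(q)$, and let $$K(\alpha,\beta,\lambda;p)=\sup_{f\in L_p(\mathbb{R}_+),\,f\neq0}\frac{|U_{\alpha,\beta,\lambda}[f]|_{q(p)}}{|f|_p}.$$ Let $1\le A<B\le\infty$ and $\psi\in\Psi(A,B)$, and suppose $(a,b):=(A,B)\cap(p_-,p_+)\neq\emptyset$. Define $\psi_{a,b}(p)=\psi(p)$ for $p\in(a,b)$ (and $0$ otherwise), and $\psi_K(q)=K(\alpha,\beta,\lambda;p(q))\cdot\psi(p(q))$ for $p(q)\in(a,b)$. Then for every measurable $f:\mathbb{R}_+\to\mathbb{R}$ with $f\in G(\psi)$, $$\|U_{\alpha,\beta,\lambda}[f]\|_{G(\psi_K)}\le 1\cdot\|f\|_{G(\psi_{a,b})},$$ and the constant $1$ is best possible.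
   Context: For a measurable function $g$ on $\mathbb{R}_+=(0,\infty)$, $|g|_p=\left(\int_0^\infty |g(x)|^p\,dx\right)^{1/p}$ is the Lebesgue $L_p$ norm. For $1\le A<B\le\infty$, $\Psi(A,B)$ is the set of continuous positive functions $\psi$ on the open interval $(A,B)$ with $\inf_{p\in(A,B)}\psi(p)>0$. The Grand Lebesgue Space $G(\psi)$ consists of all measurable $f:\mathbb{R}_+\to\mathbb{R}$ with finite norm $\|f\|_{G(\psi)}=\sup_{p\in(A,B)}|f|_p/\psi(p)$; for a function supported on a subinterval (such as $\psi_{a,b}$ on $(a,b)$, or $\psi_K$ on the set of $q$ with $p(q)\in(a,b)$), the supremum is taken over that subinterval. *)

theory Defs
  imports "HOL-Analysis.Analysis"
begin

definition lpnorm :: "(real \<Rightarrow> real) \<Rightarrow> real \<Rightarrow> ennreal" where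
  "lpnorm g p =
     (let I = (\<integral>\<^sup>+ x \<in> {0<..}. ennreal (\<bar>g x\<bar> powr p) \<partial>lborel)
      in if I = \<infinity> then \<infinity> else ennreal (enn2real I powr (1 / p)))"

definition Uop :: "real \<Rightarrow> real \<Rightarrow> real \<Rightarrow> (real \<Rightarrow> real) \<Rightarrow> real \<Rightarrow> real" where
  "Uop \<alpha> \<beta> lam f x =
     x powr (-\<beta>) * (LINT y:{0<..<x}|lborel. y powr (-\<alpha>) * f y / \<bar>x - y\<bar> powr lam)"

text \<open>q(p) defined by 1 + 1/q = 1/p + kappa, and its inverse p(q).\<close>
definition qexp :: "real \<Rightarrow> real \<Rightarrow> real \<Rightarrow> real \<Rightarrow> real" where
  "qexp \<alpha> \<beta> lam p = 1 / (1 / p + (\<alpha> + \<beta> + lam) - 1)"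

definition pexp :: "real \<Rightarrow> real \<Rightarrow> real \<Rightarrow> real \<Rightarrow> real" where
  "pexp \<alpha> \<beta> lam q = 1 / (1 + 1 / q - (\<alpha> + \<beta> + lam))"

definition in_Lp :: "real \<Rightarrow> (real \<Rightarrow> real) \<Rightarrow> bool" where
  "in_Lp p f \<longleftrightarrow> f \<in> borel_measurable lborel \<and> lpnorm f p < \<infinity>"

definition Kconst :: "real \<Rightarrow> real \<Rightarrow> real \<Rightarrow> real \<Rightarrow> ennreal" where
  "Kconst \<alpha> \<beta> lam p =
     (SUP f \<in> {f. in_Lp p f \<and> lpnorm f p \<noteq> 0}.
        lpnorm (Uop \<alpha> \<beta> lam f) (qexp \<alpha> \<beta> lam p) / lpnorm f p)"

definition gls_norm :: "(real \<Rightarrow> ennreal) \<Rightarrow> real set \<Rightarrow> (real \<Rightarrow> real) \<Rightarrow> ennreal" where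
  "gls_norm w S f = (SUP p \<in> S. lpnorm f p / w p)"

definition PsiAB :: "real \<Rightarrow> ereal \<Rightarrow> (real \<Rightarrow> real) \<Rightarrow> bool" where
  "PsiAB A B \<psi> \<longleftrightarrow>
     continuous_on {p. A < p \<and> ereal p < B} \<psi> \<and>
     (\<forall>p. A < p \<and> ereal p < B \<longrightarrow> \<psi> p > 0) \<and>
     (\<exists>\<epsilon>>0. \<forall>p. A < p \<and> ereal p < B \<longrightarrow> \<psi> p \<ge> \<epsilon>)"

end

theory Submission
  imports Defs
begin

text \<open>
  The inequality is the definition of \<open>K\<close>, applied for each \<open>p\<close> separately. For the sharpness, pass to
  the variable \<open>s = 1 / p\<close>. Only \<open>p_-\<close> is a singular exponent: the kernel lives on \<open>y < x\<close>, so
  \<open>K\<close> is finite for all \<open>s\<close> in the open interval from \<open>1 - kappa\<close> to \<open>1 - \<alpha>\<close>, which contains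
  \<open>1 / p_+\<close>. Because the kernel is positive, Hoelder's inequality makes \<open>K\<close> log-convex in \<open>s\<close>, hence
  continuous, and the norms of a fixed \<open>f\<close> and of \<open>Uf\<close> are log-convex in \<open>s\<close> as well. So a bounded,
  boundedly supported near-extremizer for the right end point \<open>b\<close> of the range of \<open>p\<close> is a
  near-extremizer for all \<open>p\<close> near \<open>b\<close>. Replacing \<open>f\<close> by \<open>f (d x)\<close> multiplies both norms by
  \<open>d powr (- 1 / p)\<close>; for large \<open>d\<close> this concentrates the suprema over \<open>p\<close> near \<open>b\<close>, whatever the
  weight \<open>\<psi>\<close> is.
\<close>

section \<open>Real powers and Hoelder's inequality for extended nonnegative reals\<close>

text \<open>The case split copies that of \<open>lpnorm\<close>: \<open>top\<close> goes to
  \<open>top\<close> and 0 to 0 for every exponent. With these values the laws for products and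
  iterated powers hold for all arguments, the convention \<open>0 * top = 0\<close>
  included.\<close>

definition ennreal_powr :: "ennreal \<Rightarrow> real \<Rightarrow> ennreal" where
  "ennreal_powr x a = (if x = \<infinity> then \<infinity> else ennreal (enn2real x powr a))"

lemma ennreal_powr_ennreal [simp]: "0 \<le> r \<Longrightarrow> ennreal_powr (ennreal r) a = ennreal (r powr a)"
  by (simp add: ennreal_powr_def)

lemma ennreal_powr_top [simp]: "ennreal_powr top a = top"
  by (simp add: ennreal_powr_def)

lemma ennreal_powr_0 [simp]: "ennreal_powr 0 a = 0"
  by (simp add: ennreal_powr_def)

lemma ennreal_powr_1_left [simp]: "ennreal_powr 1 a = 1"
  by (simp add: ennreal_powr_def)

lemma ennreal_powr_1_right [simp]: "ennreal_powr x 1 = x"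
  by (cases x) (simp_all add: ennreal_powr_def)

lemma ennreal_powr_eq_0_iff [simp]: "ennreal_powr x a = 0 \<longleftrightarrow> x = 0"
  by (cases x) (auto simp: ennreal_powr_def ennreal_eq_0_iff)

lemma ennreal_powr_eq_top_iff [simp]: "ennreal_powr x a = top \<longleftrightarrow> x = top"
  by (cases x) (auto simp: ennreal_powr_def)

lemma ennreal_powr_less_top_iff [simp]: "ennreal_powr x a < top \<longleftrightarrow> x < top"
  by (cases x) (auto simp: ennreal_powr_def)

lemma measurable_ennreal_powr [measurable]: "(\<lambda>x. ennreal_powr x a) \<in> borel_measurable borel"
  unfolding ennreal_powr_def by measurable

lemma ennreal_powr_mono: "x \<le> y \<Longrightarrow> 0 \<le> a \<Longrightarrow> ennreal_powr x a \<le> ennreal_powr y a"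
  by (cases x; cases y) (auto simp: top_unique intro!: ennreal_leI powr_mono2)

lemma ennreal_powr_mult: "ennreal_powr (x * y) a = ennreal_powr x a * ennreal_powr y a"
proof (cases "x = 0 \<or> y = 0")
  case True
  then show ?thesis by auto
next
  case False
  then show ?thesis
    by (cases x; cases y)
      (auto simp: ennreal_mult[symmetric] powr_mult ennreal_mult_top ennreal_top_mult ennreal_eq_0_iff)
qed

lemma ennreal_powr_powr: "ennreal_powr (ennreal_powr x a) b = ennreal_powr x (a * b)"
  by (cases x) (auto simp: powr_powr)

lemma ennreal_powr_add: "ennreal_powr x a * ennreal_powr x b = ennreal_powr x (a + b)"
  by (cases x) (auto simp: powr_add ennreal_mult)

lemma ennreal_powr_indicator: "ennreal_powr (x * indicator A t) a = ennreal_powr x a * indicator A t"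
  by (auto simp: indicator_def)

text \<open>For a positive exponent the map is an order isomorphism whose inverse is the power
  \<open>1/a\<close>; monotonicity in both directions gives the two inequalities.\<close>

lemma ennreal_powr_SUP:
  fixes f :: "'i \<Rightarrow> ennreal"
  assumes "0 < a" "I \<noteq> {}" shows "ennreal_powr (SUP i\<in>I. f i) a = (SUP i\<in>I. ennreal_powr (f i) a)"
proof (rule antisym)
  have "(SUP i\<in>I. f i) \<le> ennreal_powr (SUP i\<in>I. ennreal_powr (f i) a) (1/a)"
  proof (rule SUP_least)
    fix i assume "i \<in> I"
    then have "ennreal_powr (ennreal_powr (f i) a) (1/a) \<le> ennreal_powr (SUP i\<in>I. ennreal_powr (f i) a) (1/a)"
      using assms by (intro ennreal_powr_mono SUP_upper) auto
    then show "f i \<le> ennreal_powr (SUP i\<in>I. ennreal_powr (f i) a) (1/a)"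
      using assms by (simp add: ennreal_powr_powr)
  qed
  then have "ennreal_powr (SUP i\<in>I. f i) a \<le> ennreal_powr (ennreal_powr (SUP i\<in>I. ennreal_powr (f i) a) (1/a)) a"
    using assms by (intro ennreal_powr_mono) auto
  then show "ennreal_powr (SUP i\<in>I. f i) a \<le> (SUP i\<in>I. ennreal_powr (f i) a)"
    using assms by (simp add: ennreal_powr_powr)
  show "(SUP i\<in>I. ennreal_powr (f i) a) \<le> ennreal_powr (SUP i\<in>I. f i) a"
    using assms by (intro SUP_least ennreal_powr_mono SUP_upper) auto
qed

lemma ennreal_powr_Young:
  assumes "0 < a" "0 < b" "a + b = 1"
  shows "ennreal_powr x a * ennreal_powr y b \<le> ennreal a * x + ennreal b * y"
proof (cases "x = 0 \<or> y = 0 \<or> x = top \<or> y = top")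
  case True
  then show ?thesis using assms
    by (auto simp: ennreal_mult_top)
next
  case False
  then obtain r s where rs: "x = ennreal r" "y = ennreal s" "0 < r" "0 < s"
    by (cases x; cases y) (auto simp: less_le)
  then show ?thesis
    using Youngs_inequality_0[of a b r s] assms
    by (simp add: ennreal_mult[symmetric] ennreal_plus[symmetric] del: ennreal_plus)
qed

text \<open>Divide \<open>u\<close> and \<open>v\<close> by their integrals, apply Young's
  inequality pointwise and integrate. This needs integrals strictly between 0 and
  \<open>top\<close>, so the other values come first: a zero integral kills the product almost
  everywhere, and an infinite one next to a nonzero one makes the right side infinite.\<close>

lemma nn_integral_Hoelder:
  assumes [measurable]: "u \<in> borel_measurable M" "v \<in> borel_measurable M"
    and ab: "0 < a" "0 < b" "a + b = 1"
  shows "(\<integral>\<^sup>+x. ennreal_powr (u x) a * ennreal_powr (v x) b \<partial>M)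
           \<le> ennreal_powr (\<integral>\<^sup>+x. u x \<partial>M) a * ennreal_powr (\<integral>\<^sup>+x. v x \<partial>M) b"
proof -
  define I J where "I = (\<integral>\<^sup>+x. u x \<partial>M)" and "J = (\<integral>\<^sup>+x. v x \<partial>M)"
  consider "I = 0 \<or> J = 0" | "I \<noteq> 0" "J \<noteq> 0" "I = top \<or> J = top"
    | "I \<noteq> 0" "J \<noteq> 0" "I < top" "J < top"
    using top.not_eq_extremum by blast
  then show ?thesis
  proof cases
    case 1
    then have "(AE x in M. u x = 0) \<or> (AE x in M. v x = 0)"
      by (auto simp: I_def J_def nn_integral_0_iff_AE)
    then have "AE x in M. ennreal_powr (u x) a * ennreal_powr (v x) b = 0"
      by auto
    then have "(\<integral>\<^sup>+x. ennreal_powr (u x) a * ennreal_powr (v x) b \<partial>M) = 0"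
      by (subst nn_integral_0_iff_AE) auto
    then show ?thesis by simp
  next
    case 2
    then show ?thesis
      unfolding I_def[symmetric] J_def[symmetric] using ab
      by (auto simp: ennreal_mult_top ennreal_top_mult)
  next
    case 3
    have inv': "inverse I * I = 1" if "I \<noteq> 0" "I < top" for I :: ennreal
      using ennreal_divide_self[OF that] by (simp add: divide_ennreal_def mult.commute)
    have inv: "ennreal_powr I a * ennreal_powr (inverse I) a = 1" if "I \<noteq> 0" "I < top" for I a
      using inv'[OF that] by (simp flip: ennreal_powr_mult add: mult.commute)
    have "ennreal_powr (u x) a * ennreal_powr (v x) b
        \<le> (ennreal_powr I a * ennreal_powr J b) * (ennreal a * inverse I * u x + ennreal b * inverse J * v x)" for x
    proof -
      have "ennreal_powr (u x) a * ennreal_powr (v x) b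
          = (ennreal_powr I a * ennreal_powr (inverse I) a) * (ennreal_powr J b * ennreal_powr (inverse J) b) * (ennreal_powr (u x) a * ennreal_powr (v x) b)"
        using 3 by (simp add: inv)
      also have "\<dots> = (ennreal_powr I a * ennreal_powr J b) * (ennreal_powr (inverse I * u x) a * ennreal_powr (inverse J * v x) b)"
        by (simp add: ennreal_powr_mult mult_ac)
      also have "\<dots> \<le> (ennreal_powr I a * ennreal_powr J b) * (ennreal a * (inverse I * u x) + ennreal b * (inverse J * v x))"
        using ab by (intro mult_left_mono ennreal_powr_Young) auto
      finally show ?thesis by (simp add: mult_ac)
    qed
    then have "(\<integral>\<^sup>+x. ennreal_powr (u x) a * ennreal_powr (v x) b \<partial>M)
        \<le> (\<integral>\<^sup>+x. (ennreal_powr I a * ennreal_powr J b) * (ennreal a * inverse I * u x + ennreal b * inverse J * v x) \<partial>M)"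
      by (intro nn_integral_mono)
    also have "\<dots> = (ennreal_powr I a * ennreal_powr J b) * (ennreal a * inverse I * I + ennreal b * inverse J * J)"
      by (simp add: nn_integral_cmult nn_integral_add I_def J_def)
    also have "ennreal a * inverse I * I + ennreal b * inverse J * J = ennreal a + ennreal b"
      using 3 by (simp add: mult.assoc inv')
    also have "\<dots> = 1"
      using ab by (simp flip: ennreal_plus)
    finally show ?thesis by (simp add: I_def J_def)
  qed
qed

section \<open>L_p norms and the integral operator on nonnegative functions\<close>

definition Lnorm :: "(real \<Rightarrow> ennreal) \<Rightarrow> real \<Rightarrow> ennreal" where
  "Lnorm g p = ennreal_powr (\<integral>\<^sup>+x. ennreal_powr (g x) p \<partial>lborel) (1 / p)"

text \<open>Extension by zero lets all norms and integrals run over the whole real line.\<close>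

definition abs_pos :: "(real \<Rightarrow> real) \<Rightarrow> real \<Rightarrow> ennreal" where
  "abs_pos f x = ennreal \<bar>f x\<bar> * indicator {0<..} x"

lemma measurable_abs_pos [measurable]:
  assumes [measurable]: "f \<in> borel_measurable borel"
  shows "abs_pos f \<in> borel_measurable borel"
  unfolding abs_pos_def[abs_def] by measurable

lemma lpnorm_eq_Lnorm: "lpnorm f p = Lnorm (abs_pos f) p"
proof -
  have "(\<integral>\<^sup>+ x \<in> {0<..}. ennreal (\<bar>f x\<bar> powr p) \<partial>lborel) = (\<integral>\<^sup>+ x. ennreal_powr (abs_pos f x) p \<partial>lborel)"
    by (intro nn_integral_cong) (auto simp: abs_pos_def ennreal_powr_indicator)
  then show ?thesis
    by (simp add: lpnorm_def Lnorm_def ennreal_powr_def Let_def)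
qed

lemma Lnorm_mono: "(\<And>x. g x \<le> h x) \<Longrightarrow> 0 < p \<Longrightarrow> Lnorm g p \<le> Lnorm h p"
  unfolding Lnorm_def by (intro ennreal_powr_mono nn_integral_mono) auto

lemma Lnorm_cong_AE: "AE x in lborel. g x = h x \<Longrightarrow> Lnorm g p = Lnorm h p"
  unfolding Lnorm_def by (intro arg_cong[where f="\<lambda>x. ennreal_powr x (1 / p)"] nn_integral_cong_AE) auto

lemma Lnorm_cmult:
  assumes [measurable]: "g \<in> borel_measurable borel" and "0 < p"
  shows "Lnorm (\<lambda>x. c * g x) p = c * Lnorm g p"
  using assms(2) by (simp add: Lnorm_def ennreal_powr_mult nn_integral_cmult ennreal_powr_powr)

lemma Lnorm_eq_0_iff:
  assumes [measurable]: "g \<in> borel_measurable borel"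
  shows "Lnorm g p = 0 \<longleftrightarrow> (AE x in lborel. g x = 0)"
  by (simp add: Lnorm_def nn_integral_0_iff_AE)

lemma AE_finite_if_Lnorm_finite:
  assumes [measurable]: "g \<in> borel_measurable borel" and "Lnorm g p < top"
  shows "AE x in lborel. g x < top"
proof -
  have "(\<integral>\<^sup>+x. ennreal_powr (g x) p \<partial>lborel) \<noteq> \<infinity>"
    using assms(2) by (auto simp: Lnorm_def)
  then have "AE x in lborel. ennreal_powr (g x) p \<noteq> \<infinity>"
    by (intro nn_integral_PInf_AE) auto
  then show ?thesis
    by eventually_elim (simp add: less_top)
qed

text \<open>The reciprocals of the exponents are what is interpolated linearly, hence the later use
  of the variable \<open>s = 1 / p\<close>. Multiplying \<open>eq\<close> by \<open>q\<close> turns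
  its two summands into Hoelder weights \<open>a\<close> and \<open>b\<close> with sum 1.\<close>

lemma Lnorm_Hoelder:
  assumes [measurable]: "u \<in> borel_measurable borel" "v \<in> borel_measurable borel"
    and t: "0 < t" "t < 1" and q: "0 < q0" "0 < q1" and eq: "1 / q = (1 - t) / q0 + t / q1"
  shows "Lnorm (\<lambda>x. ennreal_powr (u x) (1 - t) * ennreal_powr (v x) t) q \<le> ennreal_powr (Lnorm u q0) (1 - t) * ennreal_powr (Lnorm v q1) t"
proof -
  have "0 < 1 / q" unfolding eq using t q by (intro add_pos_pos divide_pos_pos) auto
  then have "0 < q" by simp
  define a b where "a = (1 - t) * q / q0" and "b = t * q / q1"
  have "q * (1 / q) = q * ((1 - t) / q0 + t / q1)" by (simp add: eq)
  then have ab: "0 < a" "0 < b" "a + b = 1"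
    using \<open>0 < q\<close> t q by (auto simp: a_def b_def field_simps)
  have "(\<integral>\<^sup>+x. ennreal_powr (ennreal_powr (u x) (1 - t) * ennreal_powr (v x) t) q \<partial>lborel)
      = (\<integral>\<^sup>+x. ennreal_powr (ennreal_powr (u x) q0) a * ennreal_powr (ennreal_powr (v x) q1) b \<partial>lborel)"
    using q by (intro nn_integral_cong) (simp add: ennreal_powr_mult ennreal_powr_powr a_def b_def)
  also have "\<dots> \<le> ennreal_powr (\<integral>\<^sup>+x. ennreal_powr (u x) q0 \<partial>lborel) a * ennreal_powr (\<integral>\<^sup>+x. ennreal_powr (v x) q1 \<partial>lborel) b"
    using ab by (intro nn_integral_Hoelder) auto
  finally have "Lnorm (\<lambda>x. ennreal_powr (u x) (1 - t) * ennreal_powr (v x) t) q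
      \<le> ennreal_powr (ennreal_powr (\<integral>\<^sup>+x. ennreal_powr (u x) q0 \<partial>lborel) a * ennreal_powr (\<integral>\<^sup>+x. ennreal_powr (v x) q1 \<partial>lborel) b) (1 / q)"
    unfolding Lnorm_def using \<open>0 < q\<close> by (intro ennreal_powr_mono) auto
  also have "\<dots> = ennreal_powr (Lnorm u q0) (1 - t) * ennreal_powr (Lnorm v q1) t"
    using \<open>0 < q\<close> q by (simp add: Lnorm_def ennreal_powr_mult ennreal_powr_powr a_def b_def)
  finally show ?thesis .
qed

lemma Lnorm_logconvex:
  assumes "g \<in> borel_measurable borel" "0 < t" "t < 1" "0 < q0" "0 < q1"
    and "1 / q = (1 - t) / q0 + t / q1"
  shows "Lnorm g q \<le> ennreal_powr (Lnorm g q0) (1 - t) * ennreal_powr (Lnorm g q1) t"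
  using Lnorm_Hoelder[OF assms(1,1-6)] by (simp add: ennreal_powr_add)

text \<open>Powers move a function from one L_p space to another; \<open>K_logconvex\<close> uses
  this to write a single function as a product of functions in the two end point spaces.\<close>

lemma Lnorm_ennreal_powr:
  assumes "0 < p0" "0 < p"
  shows "Lnorm (\<lambda>x. ennreal_powr (g x) (p / p0)) p0 = ennreal_powr (Lnorm g p) (p / p0)"
  using assms by (simp add: Lnorm_def ennreal_powr_powr)

lemma Lnorm_dilate:
  assumes [measurable]: "g \<in> borel_measurable borel" and "0 < d" "0 < p"
  shows "Lnorm (\<lambda>x. g (d * x)) p = ennreal (d powr (- 1 / p)) * Lnorm g p"
proof -
  have "(\<integral>\<^sup>+x. ennreal_powr (g x) p \<partial>lborel) = ennreal d * (\<integral>\<^sup>+x. ennreal_powr (g (d * x)) p \<partial>lborel)"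
    using assms by (subst nn_integral_real_affine[where c=d and t=0]) auto
  then have "Lnorm g p = ennreal (d powr (1 / p)) * Lnorm (\<lambda>x. g (d * x)) p"
    using assms by (simp add: Lnorm_def ennreal_powr_mult)
  then have "ennreal (d powr (- 1 / p)) * Lnorm g p
      = ennreal (d powr (- 1 / p) * d powr (1 / p)) * Lnorm (\<lambda>x. g (d * x)) p"
    by (simp add: ennreal_mult mult.assoc)
  also have "d powr (- 1 / p) * d powr (1 / p) = 1"
    using assms by (simp flip: powr_add)
  finally show ?thesis by simp
qed

lemma Lnorm_SUP:
  assumes g: "incseq g" and [measurable]: "\<And>i. g i \<in> borel_measurable borel" and p: "0 < p"
  shows "Lnorm (\<lambda>x. SUP i. g i x) p = (SUP i::nat. Lnorm (g i) p)"
proof -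
  have "incseq (\<lambda>i x. ennreal_powr (g i x) p)"
    using g p by (auto simp: incseq_def le_fun_def intro!: ennreal_powr_mono)
  then show ?thesis
    using p unfolding Lnorm_def by (simp add: ennreal_powr_SUP nn_integral_monotone_convergence_SUP)
qed

section \<open>The positive integral operator: monotone limits, Hoelder's inequality,
  dilations\<close>

locale potential =
  fixes \<alpha> \<beta> l :: real
  assumes params: "0 < \<alpha>" "0 < \<beta>" "0 < l" "\<alpha> + \<beta> + l < 1"
begin

definition kappa :: real where "kappa = \<alpha> + \<beta> + l"

text \<open>The outer weight in \<open>x\<close> is absorbed into the kernel, so that
  \<open>V\<close> is plain integration against \<open>ker\<close>; it is always defined, possibly
  infinite, and replaces \<open>Uop\<close> on nonnegative functions.\<close>

definition ker :: "real \<Rightarrow> real \<Rightarrow> ennreal" where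
  "ker x y = (if 0 < y \<and> y < x then ennreal (x powr (-\<beta>) * y powr (-\<alpha>) * (x - y) powr (-l)) else 0)"

definition V :: "(real \<Rightarrow> ennreal) \<Rightarrow> real \<Rightarrow> ennreal" where
  "V g x = (\<integral>\<^sup>+y. ker x y * g y \<partial>lborel)"

lemma measurable_ker [measurable]:
  assumes [measurable]: "f \<in> borel_measurable M" "g \<in> borel_measurable M"
  shows "(\<lambda>z. ker (f z) (g z)) \<in> borel_measurable M"
  unfolding ker_def by measurable

lemma measurable_V [measurable]:
  assumes [measurable]: "g \<in> borel_measurable borel"
  shows "V g \<in> borel_measurable borel"
  unfolding V_def[abs_def] by measurable

lemma V_mono: "(\<And>x. g x \<le> h x) \<Longrightarrow> V g x \<le> V h x"
  unfolding V_def by (intro nn_integral_mono mult_left_mono) auto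

lemma V_SUP:
  assumes g: "incseq g" and [measurable]: "\<And>i. g i \<in> borel_measurable borel"
  shows "V (\<lambda>x. SUP i. g i x) x = (SUP i::nat. V (g i) x)"
proof -
  have "incseq (\<lambda>i y. ker x y * g i y)"
    using g by (auto simp: incseq_def le_fun_def intro!: mult_left_mono)
  then show ?thesis
    unfolding V_def
    by (subst nn_integral_monotone_convergence_SUP[symmetric]) (auto simp: SUP_mult_left_ennreal)
qed

text \<open>Since the kernel is nonnegative it splits into its powers \<open>1 - t\<close> and
  \<open>t\<close>, one for each factor.\<close>

lemma V_Hoelder:
  assumes [measurable]: "u \<in> borel_measurable borel" "v \<in> borel_measurable borel"
    and t: "0 < t" "t < 1"
  shows "V (\<lambda>y. ennreal_powr (u y) (1 - t) * ennreal_powr (v y) t) x \<le> ennreal_powr (V u x) (1 - t) * ennreal_powr (V v x) t"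
proof -
  have "ker x y * (ennreal_powr (u y) (1 - t) * ennreal_powr (v y) t)
      = ennreal_powr (ker x y * u y) (1 - t) * ennreal_powr (ker x y * v y) t" for y
  proof -
    have "ker x y = ennreal_powr (ker x y) (1 - t) * ennreal_powr (ker x y) t" by (simp add: ennreal_powr_add)
    then have "ker x y * (ennreal_powr (u y) (1 - t) * ennreal_powr (v y) t)
        = (ennreal_powr (ker x y) (1 - t) * ennreal_powr (ker x y) t) * (ennreal_powr (u y) (1 - t) * ennreal_powr (v y) t)" by simp
    then show ?thesis by (simp add: ennreal_powr_mult mult_ac)
  qed
  then show ?thesis
    using t unfolding V_def by (simp add: nn_integral_Hoelder)
qed

lemma ker_dilate:
  assumes "0 < d"
  shows "ker x y = ennreal (d powr kappa) * ker (d * x) (d * y)"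
proof (cases "0 < y \<and> y < x")
  case True
  have "(d * x - d * y) powr (-l) = d powr (-l) * (x - y) powr (-l)"
    using True assms by (simp add: powr_mult flip: right_diff_distrib)
  moreover have "d powr kappa * (d powr (-\<beta>) * d powr (-\<alpha>) * d powr (-l)) = 1"
    using assms by (simp add: kappa_def flip: powr_add)
  ultimately show ?thesis
    using True assms
    by (simp add: ker_def powr_mult algebra_simps flip: ennreal_mult)
next
  case False
  then show ?thesis using assms by (auto simp: ker_def zero_less_mult_iff)
qed

text \<open>The homogeneity of the kernel contributes \<open>d powr kappa\<close>, the change of
  variable the factor \<open>1 / d\<close>.\<close>

lemma V_dilate:
  assumes [measurable]: "g \<in> borel_measurable borel" and d: "0 < d"
  shows "V (\<lambda>y. g (d * y)) x = ennreal (d powr (kappa - 1)) * V g (d * x)"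
proof -
  have "V g (d * x) = ennreal d * (\<integral>\<^sup>+y. ker (d * x) (d * y) * g (d * y) \<partial>lborel)"
    unfolding V_def using d by (subst nn_integral_real_affine[where c=d and t=0]) auto
  then have "ennreal (d powr (kappa - 1)) * V g (d * x)
      = ennreal (d powr (kappa - 1) * d) * (\<integral>\<^sup>+y. ker (d * x) (d * y) * g (d * y) \<partial>lborel)"
    using d by (simp add: ennreal_mult mult.assoc)
  also have "d powr (kappa - 1) * d = d powr kappa"
    using d by (simp add: powr_diff)
  also have "ennreal (d powr kappa) * (\<integral>\<^sup>+y. ker (d * x) (d * y) * g (d * y) \<partial>lborel)
      = V (\<lambda>y. g (d * y)) x"
    unfolding V_def by (simp add: ker_dilate[OF d, of x] mult.assoc nn_integral_cmult)
  finally show ?thesis by simp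
qed

end

section \<open>Boundedness of the operator\<close>

lemma nn_integral_Hoelder3:
  assumes [measurable]: "u \<in> borel_measurable M" "v \<in> borel_measurable M" "w \<in> borel_measurable M"
    and abc: "0 < a" "0 < b" "0 < c" "a + b + c = 1"
  shows "(\<integral>\<^sup>+x. ennreal_powr (u x) a * ennreal_powr (v x) b * ennreal_powr (w x) c \<partial>M)
           \<le> ennreal_powr (\<integral>\<^sup>+x. u x \<partial>M) a * ennreal_powr (\<integral>\<^sup>+x. v x \<partial>M) b * ennreal_powr (\<integral>\<^sup>+x. w x \<partial>M) c"
proof -
  define s where "s = a + b"
  have s: "0 < s" "a / s + b / s = 1" "s + c = 1"
    using abc by (auto simp: s_def simp flip: add_divide_distrib)
  have "(\<integral>\<^sup>+x. ennreal_powr (u x) a * ennreal_powr (v x) b * ennreal_powr (w x) c \<partial>M)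
      = (\<integral>\<^sup>+x. ennreal_powr (ennreal_powr (u x) (a / s) * ennreal_powr (v x) (b / s)) s * ennreal_powr (w x) c \<partial>M)"
    using s by (simp add: ennreal_powr_mult ennreal_powr_powr)
  also have "\<dots> \<le> ennreal_powr (\<integral>\<^sup>+x. ennreal_powr (u x) (a / s) * ennreal_powr (v x) (b / s) \<partial>M) s * ennreal_powr (\<integral>\<^sup>+x. w x \<partial>M) c"
    using s abc by (intro nn_integral_Hoelder) auto
  also have "\<dots> \<le> ennreal_powr (ennreal_powr (\<integral>\<^sup>+x. u x \<partial>M) (a / s) * ennreal_powr (\<integral>\<^sup>+x. v x \<partial>M) (b / s)) s
      * ennreal_powr (\<integral>\<^sup>+x. w x \<partial>M) c"
    using s abc by (intro mult_right_mono ennreal_powr_mono nn_integral_Hoelder) auto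
  finally show ?thesis
    using s by (simp add: ennreal_powr_mult ennreal_powr_powr)
qed

text \<open>For \<open>0 < y < x\<close> this is (y/x)^e (1 - y/x)^(-c), a function of y/x alone,
  written with separate powers to match \<open>ker\<close>. It is integrated against the dilation
  invariant measures dx/x and dy/y.\<close>

definition hom_ker :: "real \<Rightarrow> real \<Rightarrow> real \<Rightarrow> real \<Rightarrow> ennreal" where
  "hom_ker e c x y = (if 0 < y \<and> y < x then ennreal (x powr (c - e) * y powr e * (x - y) powr (- c)) else 0)"

lemma measurable_hom_ker [measurable]:
  assumes [measurable]: "f \<in> borel_measurable M" "g \<in> borel_measurable M"
  shows "(\<lambda>z. hom_ker e c (f z) (g z)) \<in> borel_measurable M"
  unfolding hom_ker_def by measurable

lemma hom_ker_dilate: 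
  assumes "0 < d" shows "hom_ker e c (d * x) (d * y) = hom_ker e c x y"
proof (cases "0 < y \<and> y < x")
  case True
  have "(d * x - d * y) powr (-c) = d powr (-c) * (x - y) powr (-c)"
    using True assms by (simp add: powr_mult flip: right_diff_distrib)
  moreover have "d powr (c - e) * (d powr e * d powr (-c)) = 1"
    using assms by (simp flip: powr_add)
  ultimately show ?thesis
    using True assms by (simp add: hom_ker_def powr_mult algebra_simps)
next
  case False
  then show ?thesis using assms by (auto simp: hom_ker_def zero_less_mult_iff)
qed

text \<open>On (0, 1) the integrand is that of the Beta integral with parameters \<open>e\<close>
  and \<open>1 - c\<close>.\<close>

lemma nn_integral_hom_ker_1_left:
  assumes "0 < e" "c < 1"
  shows "(\<integral>\<^sup>+y. hom_ker e c 1 y * ennreal (1 / y) \<partial>lborel) < top"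
proof -
  have "((\<lambda>y. y powr (e - 1) * (1 - y) powr ((1 - c) - 1)) has_integral Beta e (1 - c)) {0..1}"
    using assms by (intro has_integral_Beta_real) auto
  from nn_integral_has_integral_lebesgue[OF _ this]
  have *: "(\<integral>\<^sup>+y. ennreal (indicator {0..1} y * (y powr (e - 1) * (1 - y) powr (- c))) \<partial>lborel) < top"
    by simp
  have "(\<integral>\<^sup>+y. hom_ker e c 1 y * ennreal (1 / y) \<partial>lborel)
      \<le> (\<integral>\<^sup>+y. ennreal (indicator {0..1} y * (y powr (e - 1) * (1 - y) powr (- c))) \<partial>lborel)"
    by (intro nn_integral_mono)
      (auto simp: hom_ker_def powr_diff simp flip: ennreal_mult intro!: ennreal_leI)
  then show ?thesis using * by (rule le_less_trans)
qed

text \<open>Up to \<open>x = 2\<close> the integrand is bounded by the singularity (x - 1)^(-c),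
  integrable as \<open>c < 1\<close>; beyond 2, where \<open>x - 1\<close> is at least
  \<open>x / 2\<close>, it is bounded by a multiple of x^(-e-1), integrable as
  \<open>e > 0\<close>.\<close>

lemma nn_integral_hom_ker_1_right:
  assumes "0 < e" "0 < c" "c < 1"
  shows "(\<integral>\<^sup>+x. hom_ker e c x 1 * ennreal (1 / x) \<partial>lborel) < top"
proof -
  define f where "f z = indicator {0..1} z * z powr (- c)" for z :: real
  define g where "g z = indicator {2..} z * z powr (- e - 1)" for z :: real
  have "((\<lambda>z. z powr (- c)) has_integral (1 powr (- c + 1) / (- c + 1))) {0..1::real}"
    using assms by (intro has_integral_powr_from_0) auto
  from nn_integral_has_integral_lebesgue[OF _ this]
  have "(\<integral>\<^sup>+z. ennreal (f z) \<partial>lborel) < top"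
    by (simp add: f_def)
  then have f: "(\<integral>\<^sup>+z. ennreal (f (z - 1)) \<partial>lborel) < top"
    using nn_integral_real_affine[of "\<lambda>z. ennreal (f z)" 1 "- 1"] by (simp add: f_def)
  have "((\<lambda>z. z powr (- e - 1)) has_integral - (2 powr (- e - 1 + 1)) / (- e - 1 + 1)) {2::real..}"
    using assms by (intro has_integral_powr_to_inf) auto
  from nn_integral_has_integral_lebesgue[OF _ this]
  have g: "(\<integral>\<^sup>+z. ennreal (g z) \<partial>lborel) < top"
    by (simp add: g_def)
  have "hom_ker e c x 1 * ennreal (1 / x) \<le> ennreal (f (x - 1)) + ennreal (2 powr c) * ennreal (g x)" for x
  proof -
    consider "x \<le> 1" | "1 < x" "x \<le> 2" | "2 < x" by linarith
    then show ?thesis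
    proof cases
      case 1
      then show ?thesis by (simp add: hom_ker_def)
    next
      case 2
      have "x powr (c - e) * (1 / x) = x powr (c - e - 1)"
        using 2 by (simp add: powr_diff)
      also have "\<dots> \<le> 1"
        using 2 assms powr_mono[of "c - e - 1" 0 x] by simp
      finally have "x powr (c - e) * (1 / x) * (x - 1) powr (- c) \<le> 1 * (x - 1) powr (- c)"
        by (intro mult_right_mono) auto
      then have "hom_ker e c x 1 * ennreal (1 / x) \<le> ennreal (f (x - 1))"
        using 2 by (auto simp: hom_ker_def f_def mult_ac simp flip: ennreal_mult intro!: ennreal_leI)
      then show ?thesis by (simp add: add_increasing2)
    next
      case 3
      have "(x - 1) powr (- c) \<le> (x / 2) powr (- c)"
        using 3 assms by (intro powr_mono2') auto
      then have "x powr (c - e) * (1 / x) * (x - 1) powr (- c)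
          \<le> x powr (c - e) * (1 / x) * (x / 2) powr (- c)"
        using 3 by (intro mult_left_mono) auto
      also have "(x / 2) powr (- c) = 2 powr c * x powr (- c)"
        using 3 by (simp add: powr_divide powr_minus field_simps)
      also have "x powr (c - e) * (1 / x) * (2 powr c * x powr (- c)) = 2 powr c * x powr (- e - 1)"
        using 3 by (simp add: powr_diff powr_minus field_simps)
      finally have "hom_ker e c x 1 * ennreal (1 / x) \<le> ennreal (2 powr c) * ennreal (g x)"
        using 3 by (auto simp: hom_ker_def g_def mult_ac simp flip: ennreal_mult intro!: ennreal_leI)
      then show ?thesis by (simp add: add_increasing)
    qed
  qed
  then have "(\<integral>\<^sup>+x. hom_ker e c x 1 * ennreal (1 / x) \<partial>lborel)
      \<le> (\<integral>\<^sup>+x. ennreal (f (x - 1)) + ennreal (2 powr c) * ennreal (g x) \<partial>lborel)"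
    by (intro nn_integral_mono)
  also have "\<dots> = (\<integral>\<^sup>+x. ennreal (f (x - 1)) \<partial>lborel) + ennreal (2 powr c) * (\<integral>\<^sup>+x. ennreal (g x) \<partial>lborel)"
    by (simp add: nn_integral_add nn_integral_cmult f_def g_def)
  also have "\<dots> < top"
    using f g by (simp add: ennreal_mult_less_top)
  finally show ?thesis .
qed

text \<open>Kernel and measure dy/y are both invariant under dilations, so \<open>x\<close> can be
  scaled to 1. The next lemma does the same for \<open>y\<close>.\<close>

lemma nn_integral_hom_ker_left:
  assumes "0 < x"
  shows "(\<integral>\<^sup>+y. hom_ker e c x y * ennreal (1 / y) \<partial>lborel) = (\<integral>\<^sup>+y. hom_ker e c 1 y * ennreal (1 / y) \<partial>lborel)"
proof -
  have "(\<integral>\<^sup>+y. hom_ker e c x y * ennreal (1 / y) \<partial>lborel)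
      = ennreal x * (\<integral>\<^sup>+y. hom_ker e c (x * 1) (x * y) * ennreal (1 / (x * y)) \<partial>lborel)"
    using assms by (subst nn_integral_real_affine[where c=x and t=0]) auto
  also have "\<dots> = (\<integral>\<^sup>+y. hom_ker e c 1 y * (ennreal x * ennreal (1 / (x * y))) \<partial>lborel)"
    unfolding hom_ker_dilate[OF assms] by (subst nn_integral_cmult[symmetric]) (auto simp: mult_ac)
  also have "\<dots> = (\<integral>\<^sup>+y. hom_ker e c 1 y * ennreal (1 / y) \<partial>lborel)"
    using assms by (intro nn_integral_cong) (auto simp: hom_ker_def simp flip: ennreal_mult)
  finally show ?thesis .
qed

lemma nn_integral_hom_ker_right:
  assumes "0 < y"
  shows "(\<integral>\<^sup>+x. hom_ker e c x y * ennreal (1 / x) \<partial>lborel) = (\<integral>\<^sup>+x. hom_ker e c x 1 * ennreal (1 / x) \<partial>lborel)"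
proof -
  have "(\<integral>\<^sup>+x. hom_ker e c x y * ennreal (1 / x) \<partial>lborel)
      = ennreal y * (\<integral>\<^sup>+x. hom_ker e c (y * x) (y * 1) * ennreal (1 / (y * x)) \<partial>lborel)"
    using assms by (subst nn_integral_real_affine[where c=y and t=0]) auto
  also have "\<dots> = (\<integral>\<^sup>+x. hom_ker e c x 1 * (ennreal y * ennreal (1 / (y * x))) \<partial>lborel)"
    unfolding hom_ker_dilate[OF assms] by (subst nn_integral_cmult[symmetric]) (auto simp: mult_ac)
  also have "\<dots> = (\<integral>\<^sup>+x. hom_ker e c x 1 * ennreal (1 / x) \<partial>lborel)"
    using assms by (intro nn_integral_cong) (auto simp: hom_ker_def simp flip: ennreal_mult)
  finally show ?thesis .
qed

context potential
begin

lemma kappa_bounds: "0 < kappa" "kappa < 1" "\<alpha> < kappa" "l < kappa"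
  using params by (auto simp: kappa_def)

lemma V_eq_0: "x \<le> 0 \<Longrightarrow> V g x = 0"
proof -
  assume "x \<le> 0"
  then have "ker x y = 0" for y by (auto simp: ker_def)
  then show ?thesis by (simp add: V_def)
qed

text \<open>The exponents are 1/q and 1 - 1/p, with sum \<open>kappa\<close>. The factors 1/x and
  1/y prepare integration against dx/x and dy/y; comparing the powers of \<open>y\<close> and of
  \<open>x - y\<close> then forces \<open>e\<close> and \<open>c\<close>. The bounds on
  \<open>s\<close> make \<open>e\<close> and both exponents positive.\<close>

lemma ker_factorization:
  assumes s: "1 - kappa < s" "s < 1 - \<alpha>"
  defines "e \<equiv> (1 - \<alpha> - s) / kappa" and "c \<equiv> l / kappa"
  shows "ker x y = ennreal_powr (hom_ker e c x y * ennreal (1 / x)) (s + kappa - 1)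
                     * ennreal_powr (hom_ker e c x y * ennreal (1 / y)) (1 - s)"
proof (cases "0 < y \<and> y < x")
  case True
  define a b where "a = s + kappa - 1" and "b = 1 - s"
  have ab: "a + b = kappa" "0 < a" "0 < b"
    using s params by (auto simp: a_def b_def kappa_def)
  have ex: "(c - e) * a - a + (c - e) * b = - \<beta>"
  proof -
    have "(c - e) * a + (c - e) * b = (c - e) * kappa"
      by (simp add: ab(1)[symmetric] algebra_simps)
    also have "\<dots> = l - (1 - \<alpha> - s)"
      using kappa_bounds by (simp add: c_def e_def field_simps)
    finally show ?thesis by (simp add: a_def kappa_def)
  qed
  have ey: "e * a + e * b - b = - \<alpha>"
  proof -
    have "e * a + e * b = e * kappa"
      by (simp add: ab(1)[symmetric] algebra_simps)
    also have "\<dots> = 1 - \<alpha> - s"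
      using kappa_bounds by (simp add: e_def)
    finally show ?thesis by (simp add: b_def)
  qed
  have exy: "- c * a + - c * b = - l"
  proof -
    have "- c * a + - c * b = - c * kappa"
      by (simp add: ab(1)[symmetric] algebra_simps)
    then show ?thesis using kappa_bounds by (simp add: c_def)
  qed
  have "ennreal_powr (hom_ker e c x y * ennreal (1 / x)) a * ennreal_powr (hom_ker e c x y * ennreal (1 / y)) b
      = ennreal ((x powr ((c - e) * a) * y powr (e * a) * (x - y) powr (- c * a) * x powr (- a))
          * (x powr ((c - e) * b) * y powr (e * b) * (x - y) powr (- c * b) * y powr (- b)))"
    using True by (simp add: hom_ker_def powr_mult powr_powr powr_divide powr_minus field_simps
        flip: ennreal_mult)
  also have "(x powr ((c - e) * a) * y powr (e * a) * (x - y) powr (- c * a) * x powr (- a))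
          * (x powr ((c - e) * b) * y powr (e * b) * (x - y) powr (- c * b) * y powr (- b))
      = x powr ((c - e) * a - a + (c - e) * b) * y powr (e * a + e * b - b)
          * (x - y) powr (- c * a + - c * b)"
    by (simp add: powr_add powr_diff powr_minus field_simps)
  finally show ?thesis
    using True unfolding ex ey exy by (simp add: ker_def a_def b_def)
next
  case False
  then show ?thesis by (auto simp: ker_def hom_ker_def)
qed

text \<open>This is Young's convolution inequality on the multiplicative group \<open>(0, \<infinity>)\<close>: after
  multiplying by powers of \<open>x\<close> and \<open>y\<close> the kernel is a function of \<open>x / y\<close> that lies in \<open>L_r\<close> with
  \<open>r = 1 / kappa\<close>, because \<open>l < kappa\<close>.\<close>

lemma V_bounded:
  assumes s: "1 - kappa < s" "s < 1 - \<alpha>"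
  shows "\<exists>C<top. \<forall>g\<in>borel_measurable borel. Lnorm (V g) (1 / (s + kappa - 1)) \<le> C * Lnorm g (1 / s)"
proof -
  define e c a where "e = (1 - \<alpha> - s) / kappa" and "c = l / kappa" and "a = s + kappa - 1"
  have pos: "0 < e" "0 < c" "c < 1" "0 < a" "0 < s" "0 < 1 - s" "0 < 1 - kappa"
    using s params kappa_bounds by (auto simp: e_def c_def a_def)
  define C1 where "C1 = (\<integral>\<^sup>+y. hom_ker e c 1 y * ennreal (1 / y) \<partial>lborel)"
  define C2 where "C2 = (\<integral>\<^sup>+x. hom_ker e c x 1 * ennreal (1 / x) \<partial>lborel)"
  have C: "C1 < top" "C2 < top"
    using pos unfolding C1_def C2_def
    by (auto intro: nn_integral_hom_ker_1_left nn_integral_hom_ker_1_right)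
  show ?thesis
  proof (intro exI[of _ "ennreal_powr C2 a * ennreal_powr C1 (1 - s)"] conjI ballI)
    show "ennreal_powr C2 a * ennreal_powr C1 (1 - s) < top"
      using C by (simp add: ennreal_mult_less_top)
    fix g :: "real \<Rightarrow> ennreal" assume [measurable]: "g \<in> borel_measurable borel"
    define D where "D = (\<integral>\<^sup>+y. ennreal_powr (g y) (1 / s) \<partial>lborel)"
    define E where "E x = (\<integral>\<^sup>+y. hom_ker e c x y * ennreal (1 / x) * ennreal_powr (g y) (1 / s) \<partial>lborel)" for x
    \<comment> \<open>Hoelder with the three exponents \<open>a\<close>, \<open>1 - s\<close> and
      \<open>1 - kappa\<close>, whose sum is 1; \<open>g\<close> is divided between the first and
      the third because \<open>a + (1 - kappa) = s\<close>. Only \<open>E\<close> still depends on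
      \<open>x\<close>.\<close>
    have V: "V g x \<le> ennreal_powr (E x) a * ennreal_powr C1 (1 - s) * ennreal_powr D (1 - kappa)" for x
    proof (cases "0 < x")
      case True
      have "V g x = (\<integral>\<^sup>+y. ennreal_powr (hom_ker e c x y * ennreal (1 / x) * ennreal_powr (g y) (1 / s)) a
          * ennreal_powr (hom_ker e c x y * ennreal (1 / y)) (1 - s) * ennreal_powr (ennreal_powr (g y) (1 / s)) (1 - kappa) \<partial>lborel)"
        unfolding V_def
      proof (rule nn_integral_cong)
        fix y
        have "g y = ennreal_powr (ennreal_powr (g y) (1 / s)) a * ennreal_powr (ennreal_powr (g y) (1 / s)) (1 - kappa)"
          using pos by (simp add: ennreal_powr_powr ennreal_powr_add a_def flip: add_divide_distrib)
        then have "ker x y * g y = ker x y * (ennreal_powr (ennreal_powr (g y) (1 / s)) a * ennreal_powr (ennreal_powr (g y) (1 / s)) (1 - kappa))"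
          by simp
        then show "ker x y * g y = ennreal_powr (hom_ker e c x y * ennreal (1 / x) * ennreal_powr (g y) (1 / s)) a
          * ennreal_powr (hom_ker e c x y * ennreal (1 / y)) (1 - s) * ennreal_powr (ennreal_powr (g y) (1 / s)) (1 - kappa)"
          by (simp only: ker_factorization[OF s] e_def[symmetric] c_def[symmetric] a_def[symmetric]
              ennreal_powr_mult mult_ac)
      qed
      also have "\<dots> \<le> ennreal_powr (E x) a * ennreal_powr (\<integral>\<^sup>+y. hom_ker e c x y * ennreal (1 / y) \<partial>lborel) (1 - s)
          * ennreal_powr D (1 - kappa)"
        unfolding E_def D_def using pos by (intro nn_integral_Hoelder3) (auto simp: a_def)
      finally show ?thesis
        unfolding nn_integral_hom_ker_left[OF True] C1_def .
    qed (simp add: V_eq_0)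
    have [measurable]: "E \<in> borel_measurable borel"
      unfolding E_def[abs_def] by measurable
    \<comment> \<open>The bound is uniform in \<open>y\<close>; it controls the inner integral once
      Tonelli's theorem lets the integration over \<open>x\<close> come first.\<close>
    have H: "(\<integral>\<^sup>+x. hom_ker e c x y * ennreal (1 / x) \<partial>lborel) \<le> C2" for y
    proof (cases "0 < y")
      case True
      then show ?thesis unfolding C2_def by (intro eq_refl nn_integral_hom_ker_right)
    qed (simp add: hom_ker_def)
    have E_inner: "(\<integral>\<^sup>+x. hom_ker e c x y * ennreal (1 / x) * ennreal_powr (g y) (1 / s) \<partial>lborel)
        \<le> C2 * ennreal_powr (g y) (1 / s)" for y
    proof -
      have "(\<integral>\<^sup>+x. hom_ker e c x y * ennreal (1 / x) * ennreal_powr (g y) (1 / s) \<partial>lborel)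
          = (\<integral>\<^sup>+x. hom_ker e c x y * ennreal (1 / x) \<partial>lborel) * ennreal_powr (g y) (1 / s)"
        by (rule nn_integral_multc) measurable
      then show ?thesis using H by (simp add: mult_right_mono)
    qed
    have "(\<integral>\<^sup>+x. E x \<partial>lborel)
        = (\<integral>\<^sup>+y. \<integral>\<^sup>+x. hom_ker e c x y * ennreal (1 / x) * ennreal_powr (g y) (1 / s) \<partial>lborel \<partial>lborel)"
      unfolding E_def by (rule lborel_pair.Fubini') measurable
    also have "\<dots> \<le> (\<integral>\<^sup>+y. C2 * ennreal_powr (g y) (1 / s) \<partial>lborel)"
      by (rule nn_integral_mono) (rule E_inner)
    also have "\<dots> = C2 * D"
      by (simp add: nn_integral_cmult D_def)
    finally have E: "(\<integral>\<^sup>+x. E x \<partial>lborel) \<le> C2 * D" .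
    have "Lnorm (V g) (1 / a) \<le> Lnorm (\<lambda>x. (ennreal_powr C1 (1 - s) * ennreal_powr D (1 - kappa)) * ennreal_powr (E x) a) (1 / a)"
      using pos V by (intro Lnorm_mono) (auto simp: mult_ac)
    also have "\<dots> = (ennreal_powr C1 (1 - s) * ennreal_powr D (1 - kappa)) * Lnorm (\<lambda>x. ennreal_powr (E x) a) (1 / a)"
      using pos by (intro Lnorm_cmult) auto
    also have "Lnorm (\<lambda>x. ennreal_powr (E x) a) (1 / a) = ennreal_powr (\<integral>\<^sup>+x. E x \<partial>lborel) a"
      using pos by (simp add: Lnorm_def ennreal_powr_powr)
    also have "\<dots> \<le> ennreal_powr (C2 * D) a"
      using pos E by (intro ennreal_powr_mono) auto
    also have "(ennreal_powr C1 (1 - s) * ennreal_powr D (1 - kappa)) * ennreal_powr (C2 * D) a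
        = ennreal_powr C2 a * ennreal_powr C1 (1 - s) * (ennreal_powr D (1 - kappa) * ennreal_powr D a)"
      by (simp add: ennreal_powr_mult mult_ac)
    also have "ennreal_powr D (1 - kappa) * ennreal_powr D a = Lnorm g (1 / s)"
      using pos by (simp add: ennreal_powr_add Lnorm_def D_def a_def)
    finally show "Lnorm (V g) (1 / (s + kappa - 1)) \<le> ennreal_powr C2 a * ennreal_powr C1 (1 - s) * Lnorm g (1 / s)"
      by (simp add: a_def mult_left_mono)
  qed
qed

end

section \<open>Log-convexity of the best constant\<close>

text \<open>An interval of positive length is not a null set. \<open>K_pos\<close> uses this to
  evaluate almost everywhere statements at suitable points.\<close>

lemma AE_lborel_Ioo_ex:
  fixes a b :: real
  assumes "AE x in lborel. P x" "a < b"
  shows "\<exists>x. a < x \<and> x < b \<and> P x"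
proof (rule ccontr)
  assume "\<not> ?thesis"
  with assms(1) have "AE x in lborel. x \<notin> {a<..<b}"
    by (auto elim: eventually_mono)
  then have "{a<..<b} \<in> null_sets lborel"
    by (subst AE_iff_null_sets) auto
  then show False using \<open>a < b\<close> by (simp add: null_sets_def)
qed

text \<open>Positivity and finiteness make the logarithm real valued; it is convex on an open set,
  hence continuous, and so is its exponential.\<close>

lemma logconvex_imp_continuous_on:
  fixes F :: "real \<Rightarrow> ennreal"
  assumes S: "open S" "convex S"
    and F: "\<And>s. s \<in> S \<Longrightarrow> 0 < F s" "\<And>s. s \<in> S \<Longrightarrow> F s < top"
    and le: "\<And>s0 s1 t. \<lbrakk>s0 \<in> S; s1 \<in> S; 0 < t; t < 1\<rbrakk> \<Longrightarrow>
      F ((1 - t) * s0 + t * s1) \<le> ennreal_powr (F s0) (1 - t) * ennreal_powr (F s1) t"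
  shows "continuous_on S (\<lambda>s. enn2real (F s))"
proof -
  define f where "f s = enn2real (F s)" for s
  have f: "0 < f s" "F s = ennreal (f s)" if "s \<in> S" for s
    using F[OF that] by (auto simp: f_def enn2real_positive_iff)
  have "convex_on S (\<lambda>s. ln (f s))"
  proof (rule convex_onI)
    fix t s0 s1 :: real assume t: "0 < t" "t < 1" and s: "s0 \<in> S" "s1 \<in> S"
    define s where "s = (1 - t) * s0 + t * s1"
    have "s \<in> S" using S(2) t s by (auto simp: s_def convex_alt)
    have "ennreal (f s) \<le> ennreal_powr (ennreal (f s0)) (1 - t) * ennreal_powr (ennreal (f s1)) t"
      using le[OF s t] f[OF \<open>s \<in> S\<close>] f[OF s(1)] f[OF s(2)] by (simp add: s_def)
    also have "\<dots> = ennreal (f s0 powr (1 - t) * f s1 powr t)"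
      using f[OF s(1)] f[OF s(2)] by (simp add: ennreal_mult)
    finally have "f s \<le> f s0 powr (1 - t) * f s1 powr t"
      by (simp add: ennreal_le_iff)
    then have "ln (f s) \<le> ln (f s0 powr (1 - t) * f s1 powr t)"
      using f[OF \<open>s \<in> S\<close>] f[OF s(1)] f[OF s(2)] by (subst ln_le_cancel_iff) auto
    also have "\<dots> = (1 - t) * ln (f s0) + t * ln (f s1)"
      using f[OF s(1)] f[OF s(2)] by (simp add: ln_mult ln_powr)
    finally show "ln (f ((1 - t) *\<^sub>R s0 + t *\<^sub>R s1)) \<le> (1 - t) * ln (f s0) + t * ln (f s1)"
      by (simp add: s_def)
  qed (use S in auto)
  then have "continuous_on S (\<lambda>s. ln (f s))"
    using S by (intro convex_on_continuous)
  then have "continuous_on S (\<lambda>s. exp (ln (f s)))"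
    by (rule continuous_on_exp)
  also have "?this \<longleftrightarrow> continuous_on S f"
    using f(1) by (intro continuous_on_cong) auto
  finally show ?thesis by (simp add: f_def[abs_def])
qed

context potential
begin

section \<open>Comparing \<open>Uop\<close> with the positive operator \<open>V\<close>\<close>

lemma V_abs_pos_eq:
  assumes [measurable]: "f \<in> borel_measurable borel" and "0 < x"
  shows "V (abs_pos f) x = ennreal (x powr (-\<beta>)) *
    (\<integral>\<^sup>+y. ennreal \<bar>indicator {0<..<x} y * (y powr (-\<alpha>) * f y / \<bar>x - y\<bar> powr l)\<bar> \<partial>lborel)"
proof -
  have "V (abs_pos f) x = (\<integral>\<^sup>+y. ennreal (x powr (-\<beta>)) *
      ennreal \<bar>indicator {0<..<x} y * (y powr (-\<alpha>) * f y / \<bar>x - y\<bar> powr l)\<bar> \<partial>lborel)"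
    unfolding V_def
    by (intro nn_integral_cong)
      (auto simp: ker_def abs_pos_def indicator_def powr_minus abs_mult field_simps simp flip: ennreal_mult)
  then show ?thesis by (simp add: nn_integral_cmult)
qed

lemma abs_pos_Uop_le:
  assumes [measurable]: "f \<in> borel_measurable borel"
  shows "abs_pos (Uop \<alpha> \<beta> l f) x \<le> V (abs_pos f) x"
proof (cases "0 < x")
  case True
  define h where "h y = indicator {0<..<x} y * (y powr (-\<alpha>) * f y / \<bar>x - y\<bar> powr l)" for y
  \<comment> \<open>If \<open>h\<close> is not integrable, its integral has the default value 0 and
    the bound holds as well.\<close>
  have "ennreal \<bar>LINT y|lborel. h y\<bar> \<le> (\<integral>\<^sup>+y. ennreal \<bar>h y\<bar> \<partial>lborel)"
    using integral_norm_bound_ennreal[of lborel h] not_integrable_integral_eq[of lborel h]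
    by (cases "integrable lborel h") auto
  then have "ennreal (x powr (-\<beta>)) * ennreal \<bar>LINT y|lborel. h y\<bar> \<le> V (abs_pos f) x"
    unfolding V_abs_pos_eq[OF assms True] h_def[symmetric] by (intro mult_left_mono) auto
  moreover have "Uop \<alpha> \<beta> l f x = x powr (-\<beta>) * (LINT y|lborel. h y)"
    by (simp add: Uop_def set_lebesgue_integral_def h_def)
  ultimately show ?thesis
    using True by (simp add: abs_pos_def abs_mult ennreal_mult)
qed (simp add: abs_pos_def)

text \<open>Finiteness of \<open>V\<close> makes the integrand of \<open>Uop\<close> integrable;
  where \<open>V\<close> is infinite, \<open>Uop\<close> would take the default value 0.\<close>

lemma abs_pos_Uop_eq:
  assumes [measurable]: "f \<in> borel_measurable borel" and "\<And>x. 0 \<le> f x" and "V (abs_pos f) x < top"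
  shows "abs_pos (Uop \<alpha> \<beta> l f) x = V (abs_pos f) x"
proof (cases "0 < x")
  case True
  define h where "h y = indicator {0<..<x} y * (y powr (-\<alpha>) * f y / \<bar>x - y\<bar> powr l)" for y
  have [measurable]: "h \<in> borel_measurable borel" and h: "0 \<le> h y" for y
    using assms(2) unfolding h_def[abs_def] by auto
  have V: "V (abs_pos f) x = ennreal (x powr (-\<beta>)) * (\<integral>\<^sup>+y. ennreal (h y) \<partial>lborel)"
    unfolding V_abs_pos_eq[OF assms(1) True] h_def[symmetric] using h by simp
  then have "(\<integral>\<^sup>+y. ennreal (h y) \<partial>lborel) < top"
    using assms(3) True by (auto simp: ennreal_mult_less_top)
  then have "ennreal (LINT y|lborel. h y) = (\<integral>\<^sup>+y. ennreal (h y) \<partial>lborel)"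
    using h by (subst integral_eq_nn_integral) auto
  moreover have "0 \<le> (LINT y|lborel. h y)"
    using h by simp
  moreover have "Uop \<alpha> \<beta> l f x = x powr (-\<beta>) * (LINT y|lborel. h y)"
    by (simp add: Uop_def set_lebesgue_integral_def h_def)
  ultimately show ?thesis
    using True V by (simp add: abs_pos_def abs_mult ennreal_mult)
qed (simp add: abs_pos_def V_eq_0)

lemma lpnorm_Uop_le:
  assumes "f \<in> borel_measurable borel" "0 < q"
  shows "lpnorm (Uop \<alpha> \<beta> l f) q \<le> Lnorm (V (abs_pos f)) q"
  unfolding lpnorm_eq_Lnorm using assms by (intro Lnorm_mono abs_pos_Uop_le)

lemma lpnorm_Uop_eq:
  assumes [measurable]: "f \<in> borel_measurable borel" and "\<And>x. 0 \<le> f x" and "Lnorm (V (abs_pos f)) q < top"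
  shows "lpnorm (Uop \<alpha> \<beta> l f) q = Lnorm (V (abs_pos f)) q"
  unfolding lpnorm_eq_Lnorm
proof (rule Lnorm_cong_AE)
  have "AE x in lborel. V (abs_pos f) x < top"
    using assms(3) by (intro AE_finite_if_Lnorm_finite) auto
  then show "AE x in lborel. abs_pos (Uop \<alpha> \<beta> l f) x = V (abs_pos f) x"
    by eventually_elim (use assms in \<open>simp add: abs_pos_Uop_eq\<close>)
qed

section \<open>The best constant as a function of \<open>s = 1 / p\<close>\<close>

definition K :: "real \<Rightarrow> ennreal" where "K s = Kconst \<alpha> \<beta> l (1 / s)"

lemma qexp_inverse: "qexp \<alpha> \<beta> l (1 / s) = 1 / (s + kappa - 1)"
  by (simp add: qexp_def kappa_def)

lemma lpnorm_Uop_le_K_nonzero: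
  assumes "in_Lp (1 / s) f" "lpnorm f (1 / s) \<noteq> 0"
  shows "lpnorm (Uop \<alpha> \<beta> l f) (1 / (s + kappa - 1)) \<le> K s * lpnorm f (1 / s)"
proof -
  have "lpnorm (Uop \<alpha> \<beta> l f) (1 / (s + kappa - 1)) / lpnorm f (1 / s) \<le> K s"
    unfolding K_def Kconst_def qexp_inverse using assms by (intro SUP_upper) auto
  then have "lpnorm (Uop \<alpha> \<beta> l f) (1 / (s + kappa - 1)) / lpnorm f (1 / s) * lpnorm f (1 / s)
      \<le> K s * lpnorm f (1 / s)"
    by (intro mult_right_mono) auto
  then show ?thesis
    using assms by (simp add: in_Lp_def ennreal_divide_times ennreal_times_divide less_top
        ennreal_mult_divide_eq)
qed

lemma K_less_top:
  assumes s: "1 - kappa < s" "s < 1 - \<alpha>"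
  shows "K s < top"
proof -
  obtain C where C: "C < top"
    "\<And>g. g \<in> borel_measurable borel \<Longrightarrow> Lnorm (V g) (1 / (s + kappa - 1)) \<le> C * Lnorm g (1 / s)"
    using V_bounded[OF s] by blast
  have "K s \<le> C"
    unfolding K_def Kconst_def qexp_inverse
  proof (rule SUP_least)
    fix f assume "f \<in> {f. in_Lp (1 / s) f \<and> lpnorm f (1 / s) \<noteq> 0}"
    then have f: "f \<in> borel_measurable borel" "lpnorm f (1 / s) < top" "lpnorm f (1 / s) \<noteq> 0"
      by (auto simp: in_Lp_def)
    have "lpnorm (Uop \<alpha> \<beta> l f) (1 / (s + kappa - 1)) \<le> Lnorm (V (abs_pos f)) (1 / (s + kappa - 1))"
      using f s by (intro lpnorm_Uop_le) auto
    also have "\<dots> \<le> C * lpnorm f (1 / s)"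
      unfolding lpnorm_eq_Lnorm using f by (intro C) auto
    finally show "lpnorm (Uop \<alpha> \<beta> l f) (1 / (s + kappa - 1)) / lpnorm f (1 / s) \<le> C"
      using f by (simp add: divide_le_posI_ennreal zero_less_iff_neq_zero mult.commute)
  qed
  then show ?thesis using C(1) by (rule le_less_trans)
qed

text \<open>Carries the bound from \<open>Uop\<close> over to \<open>V\<close> and to extended real
  functions. A function of finite norm is finite almost everywhere, so it can be replaced by the
  real function \<open>f\<close> without changing \<open>V\<close>; and \<open>V_bounded\<close>
  makes the norm of \<open>V\<close> finite, so that it agrees with that of
  \<open>Uop\<close>.\<close>

lemma V_le_K:
  assumes s: "1 - kappa < s" "s < 1 - \<alpha>"
    and [measurable]: "g \<in> borel_measurable borel" and fin: "Lnorm g (1 / s) < top"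
  shows "Lnorm (V g) (1 / (s + kappa - 1)) \<le> K s * Lnorm g (1 / s)"
proof -
  obtain C where C: "C < top"
    "\<And>g. g \<in> borel_measurable borel \<Longrightarrow> Lnorm (V g) (1 / (s + kappa - 1)) \<le> C * Lnorm g (1 / s)"
    using V_bounded[OF s] by blast
  have "0 < s" using s kappa_bounds by simp
  define f where "f x = enn2real (g x)" for x
  have [measurable]: "f \<in> borel_measurable borel" and f0: "0 \<le> f x" for x
    unfolding f_def by auto
  have "abs_pos f x \<le> g x" for x
    by (cases "g x") (auto simp: abs_pos_def f_def indicator_def)
  then have le: "Lnorm (abs_pos f) (1 / s) \<le> Lnorm g (1 / s)"
    using \<open>0 < s\<close> by (intro Lnorm_mono) auto
  have "AE y in lborel. g y < top"
    using fin by (intro AE_finite_if_Lnorm_finite) auto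
  then have V: "V g x = V (abs_pos f) x" for x
    unfolding V_def
    by (intro nn_integral_cong_AE) (auto elim!: eventually_mono simp: ker_def abs_pos_def f_def)
  have Vfin: "Lnorm (V (abs_pos f)) (1 / (s + kappa - 1)) < top"
  proof -
    have "Lnorm (V (abs_pos f)) (1 / (s + kappa - 1)) \<le> C * Lnorm (abs_pos f) (1 / s)"
      by (intro C) auto
    also have "\<dots> < top"
      using C(1) le fin by (auto simp: ennreal_mult_less_top)
    finally show ?thesis .
  qed
  have "Lnorm (V (abs_pos f)) (1 / (s + kappa - 1)) \<le> K s * Lnorm (abs_pos f) (1 / s)"
  proof (cases "Lnorm (abs_pos f) (1 / s) = 0")
    \<comment> \<open>Such an \<open>f\<close> does not occur in the supremum that defines
      \<open>K\<close>; here the bound with \<open>C\<close> forces the left side to be 0.\<close>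
    case True
    then show ?thesis using C(2)[of "abs_pos f"] by simp
  next
    case False
    have "lpnorm (Uop \<alpha> \<beta> l f) (1 / (s + kappa - 1)) \<le> K s * lpnorm f (1 / s)"
      using False le fin by (intro lpnorm_Uop_le_K_nonzero) (auto simp: in_Lp_def lpnorm_eq_Lnorm)
    then show ?thesis
      using Vfin f0 by (simp add: lpnorm_Uop_eq) (simp add: lpnorm_eq_Lnorm)
  qed
  also have "\<dots> \<le> K s * Lnorm g (1 / s)"
    using le by (intro mult_left_mono) auto
  finally show ?thesis by (simp add: V Lnorm_def)
qed

lemma lpnorm_Uop_le_K:
  assumes s: "1 - kappa < s" "s < 1 - \<alpha>"
    and "f \<in> borel_measurable borel" "lpnorm f (1 / s) < top"
  shows "lpnorm (Uop \<alpha> \<beta> l f) (1 / (s + kappa - 1)) \<le> K s * lpnorm f (1 / s)"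
  using lpnorm_Uop_le[of f "1 / (s + kappa - 1)"] V_le_K[OF s, of "abs_pos f"] assms
  by (force simp: lpnorm_eq_Lnorm intro: order_trans)

text \<open>The indicator of (1, 2) is a test function: \<open>V\<close> of it is positive on (2,
  3), because the kernel is positive for \<open>y\<close> in the first and \<open>x\<close> in the
  second interval.\<close>

lemma K_pos:
  assumes s: "1 - kappa < s" "s < 1 - \<alpha>"
  shows "0 < K s"
proof (rule ccontr)
  assume "\<not> 0 < K s"
  then have "K s = 0" by (simp add: zero_less_iff_neq_zero)
  define g :: "real \<Rightarrow> ennreal" where "g = indicator {1<..<2}"
  have [measurable]: "g \<in> borel_measurable borel" by (simp add: g_def)
  have "ennreal_powr (g x) (1 / s) = g x" for x by (simp add: g_def indicator_def)
  then have "Lnorm g (1 / s) < top" by (simp add: Lnorm_def) (simp add: g_def)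
  then have "Lnorm (V g) (1 / (s + kappa - 1)) = 0"
    using V_le_K[OF s, of g] \<open>K s = 0\<close> by simp
  then have "AE x in lborel. V g x = 0"
    by (simp add: Lnorm_eq_0_iff)
  then obtain x :: real where x: "2 < x" "x < 3" "V g x = 0"
    using AE_lborel_Ioo_ex[of _ 2 3] by auto
  then have "AE y in lborel. ker x y * g y = 0"
    by (simp add: V_def nn_integral_0_iff_AE)
  then obtain y :: real where "1 < y" "y < 2" "ker x y * g y = 0"
    using AE_lborel_Ioo_ex[of _ 1 2] by auto
  then show False
    using x by (auto simp: ker_def g_def ennreal_eq_0_iff mult_le_0_iff not_le)
qed

text \<open>Riesz-Thorin interpolation for a positive kernel, where real powers of \<open>f\<close>
  take the place of an analytic family: apply Hoelder inside \<open>V\<close>, then to the norm, and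
  use the end point bounds for the two factors.\<close>

lemma K_logconvex:
  assumes s0: "1 - kappa < s0" "s0 < 1 - \<alpha>" and s1: "1 - kappa < s1" "s1 < 1 - \<alpha>"
    and t: "0 < t" "t < 1"
  shows "K ((1 - t) * s0 + t * s1) \<le> ennreal_powr (K s0) (1 - t) * ennreal_powr (K s1) t"
proof -
  define s where "s = (1 - t) * s0 + t * s1"
  have "(1 - t) * (1 - kappa) + t * (1 - kappa) < s" "s < (1 - t) * (1 - \<alpha>) + t * (1 - \<alpha>)"
    unfolding s_def using s0 s1 t by (intro add_strict_mono mult_strict_left_mono; simp)+
  then have s: "1 - kappa < s" "s < 1 - \<alpha>" by (simp_all add: algebra_simps)
  have pos: "0 < s" "0 < s0" "0 < s1"
    using s s0 s1 kappa_bounds by auto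
  have eq: "(1 - t) * (s0 / s) + t * (s1 / s) = 1"
    using pos by (simp add: s_def flip: add_divide_distrib)
  have "K s \<le> ennreal_powr (K s0) (1 - t) * ennreal_powr (K s1) t"
    unfolding K_def[of s] Kconst_def qexp_inverse
  proof (rule SUP_least)
    fix f assume "f \<in> {f. in_Lp (1 / s) f \<and> lpnorm f (1 / s) \<noteq> 0}"
    then have [measurable]: "f \<in> borel_measurable borel"
      and f: "Lnorm (abs_pos f) (1 / s) < top" "Lnorm (abs_pos f) (1 / s) \<noteq> 0"
      by (auto simp: in_Lp_def lpnorm_eq_Lnorm)
    \<comment> \<open>This power of \<open>f\<close> lies in L_(1/u), and since the exponents in
      \<open>eq\<close> sum to 1, \<open>f\<close> is the product of the powers \<open>1 - t\<close>
      of \<open>h s0\<close> and \<open>t\<close> of \<open>h s1\<close>.\<close>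
    define h where "h u x = ennreal_powr (abs_pos f x) (u / s)" for u x
    have [measurable]: "h u \<in> borel_measurable borel" for u
      unfolding h_def[abs_def] by measurable
    have Lnorm_h: "Lnorm (h u) (1 / u) = ennreal_powr (Lnorm (abs_pos f) (1 / s)) (u / s)" if "0 < u" for u
      using Lnorm_ennreal_powr[of "1 / u" "1 / s" "abs_pos f"] that pos by (simp add: h_def[abs_def])
    have h: "abs_pos f x = ennreal_powr (h s0 x) (1 - t) * ennreal_powr (h s1 x) t" for x
      using eq by (simp only: h_def ennreal_powr_powr ennreal_powr_add mult.commute[of "_ / s"] ennreal_powr_1_right)
    have "lpnorm (Uop \<alpha> \<beta> l f) (1 / (s + kappa - 1)) \<le> Lnorm (V (abs_pos f)) (1 / (s + kappa - 1))"
      using s by (intro lpnorm_Uop_le) auto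
    also have "\<dots> \<le> Lnorm (\<lambda>x. ennreal_powr (V (h s0) x) (1 - t) * ennreal_powr (V (h s1) x) t) (1 / (s + kappa - 1))"
      unfolding h[abs_def] using s t by (intro Lnorm_mono V_Hoelder) auto
    \<comment> \<open>The reciprocal target exponent \<open>s + kappa - 1\<close> is affine in
      \<open>s\<close>, so it interpolates with the same \<open>t\<close>.\<close>
    also have "\<dots> \<le> ennreal_powr (Lnorm (V (h s0)) (1 / (s0 + kappa - 1))) (1 - t)
        * ennreal_powr (Lnorm (V (h s1)) (1 / (s1 + kappa - 1))) t"
      using s0 s1 t by (intro Lnorm_Hoelder) (auto simp: s_def algebra_simps)
    also have "\<dots> \<le> ennreal_powr (K s0 * Lnorm (h s0) (1 / s0)) (1 - t) * ennreal_powr (K s1 * Lnorm (h s1) (1 / s1)) t"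
      using s0 s1 t f pos by (intro mult_mono ennreal_powr_mono V_le_K) (auto simp: Lnorm_h)
    also have "\<dots> = ennreal_powr (K s0) (1 - t) * ennreal_powr (K s1) t
        * (ennreal_powr (Lnorm (abs_pos f) (1 / s)) ((1 - t) * (s0 / s)) * ennreal_powr (Lnorm (abs_pos f) (1 / s)) (t * (s1 / s)))"
      using pos by (simp add: Lnorm_h ennreal_powr_mult ennreal_powr_powr mult_ac)
    also have "\<dots> = ennreal_powr (K s0) (1 - t) * ennreal_powr (K s1) t * lpnorm f (1 / s)"
      by (simp only: ennreal_powr_add eq ennreal_powr_1_right lpnorm_eq_Lnorm)
    finally show "lpnorm (Uop \<alpha> \<beta> l f) (1 / (s + kappa - 1)) / lpnorm f (1 / s)
        \<le> ennreal_powr (K s0) (1 - t) * ennreal_powr (K s1) t"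
      using f by (simp add: divide_le_posI_ennreal zero_less_iff_neq_zero mult.commute lpnorm_eq_Lnorm)
  qed
  then show ?thesis by (simp add: s_def)
qed

end

section \<open>Near-extremizers and dilations\<close>

lemma times_less_of_less_divide:
  fixes a b x :: ennreal
  assumes "x < a / b" "b \<noteq> 0" "b < top"
  shows "x * b < a"
proof (rule ccontr)
  assume "\<not> x * b < a"
  then have "a / b \<le> x * b / b"
    by (intro divide_right_mono_ennreal) auto
  also have "\<dots> = x"
    using assms by (simp add: ennreal_mult_divide_eq)
  finally show False using assms(1) by simp
qed

lemma cancel_weight:
  fixes n r k :: ennreal
  assumes "0 < r" "r < top"
  shows "k * r * (n / r) = k * n"
proof -
  have "n / r * r = n"
    using assms by (simp add: ennreal_divide_times ennreal_mult_divide_eq)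
  then show ?thesis by (simp add: mult_ac)
qed

text \<open>The bound does not depend on \<open>p\<close>, so such functions have finite norm for
  every weight bounded away from 0, even on an unbounded range of \<open>p\<close>.\<close>

lemma lpnorm_bounded_le:
  assumes "f \<in> borel_measurable borel" "\<And>x. 0 \<le> f x" "\<And>x. f x \<le> M * indicator {0<..<M} x"
    and "1 \<le> M" "1 \<le> p"
  shows "lpnorm f p \<le> ennreal (M * M)"
proof -
  have "(\<integral>\<^sup>+x. ennreal_powr (abs_pos f x) p \<partial>lborel) \<le> (\<integral>\<^sup>+x. ennreal (M powr p) * indicator {0<..<M} x \<partial>lborel)"
  proof (rule nn_integral_mono)
    fix x
    have "abs_pos f x \<le> ennreal M * indicator {0<..<M} x"
      using assms(2)[of x] assms(3)[of x] by (auto simp: abs_pos_def indicator_def ennreal_leI split: if_splits)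
    then have "ennreal_powr (abs_pos f x) p \<le> ennreal_powr (ennreal M * indicator {0<..<M} x) p"
      using assms by (intro ennreal_powr_mono) auto
    then show "ennreal_powr (abs_pos f x) p \<le> ennreal (M powr p) * indicator {0<..<M} x"
      using assms by (simp add: ennreal_powr_indicator)
  qed
  also have "\<dots> = ennreal (M powr p * M)"
    using assms by (simp add: nn_integral_cmult ennreal_mult)
  finally have "lpnorm f p \<le> ennreal_powr (ennreal (M powr p * M)) (1 / p)"
    unfolding lpnorm_eq_Lnorm Lnorm_def using assms by (intro ennreal_powr_mono) auto
  also have "\<dots> = ennreal (M * M powr (1 / p))"
    using assms by (simp add: powr_mult powr_powr)
  also have "\<dots> \<le> ennreal (M * M)"
    using assms powr_mono[of "1 / p" 1 M] by (intro ennreal_leI mult_left_mono) auto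
  finally show ?thesis .
qed

context potential
begin

text \<open>Start from a function almost attaining the supremum and truncate its absolute value to
  height \<open>n\<close> and support (0, n). By monotone convergence the norms of \<open>V\<close>
  increase to that of the full function, while the norms of the truncations stay below that of
  \<open>f\<close>.\<close>

lemma near_extremizer:
  assumes s: "1 - kappa < s" "s < 1 - \<alpha>" and c: "0 \<le> c" "c < 1"
  shows "\<exists>f M. f \<in> borel_measurable borel \<and> 1 \<le> M \<and> (\<forall>x. 0 \<le> f x \<and> f x \<le> M * indicator {0<..<M} x)
    \<and> ennreal c * K s * Lnorm (abs_pos f) (1 / s) < Lnorm (V (abs_pos f)) (1 / (s + kappa - 1))"
proof -
  define q where "q = 1 / (s + kappa - 1)"
  have q: "0 < q" "0 < s" using s kappa_bounds by (auto simp: q_def)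
  \<comment> \<open>Strict because \<open>K s\<close> is neither 0 nor infinite.\<close>
  have "ennreal c * K s < 1 * K s"
    using c K_pos[OF s] K_less_top[OF s]
    by (intro ennreal_mult_strict_right_mono) (auto simp flip: ennreal_1 intro!: ennreal_lessI)
  then have "ennreal c * K s < (SUP f \<in> {f. in_Lp (1 / s) f \<and> lpnorm f (1 / s) \<noteq> 0}.
      lpnorm (Uop \<alpha> \<beta> l f) q / lpnorm f (1 / s))"
    by (simp add: K_def Kconst_def qexp_inverse q_def)
  then obtain f where f: "in_Lp (1 / s) f" "lpnorm f (1 / s) \<noteq> 0"
    and less: "ennreal c * K s < lpnorm (Uop \<alpha> \<beta> l f) q / lpnorm f (1 / s)"
    by (auto simp: less_SUP_iff)
  have [measurable]: "f \<in> borel_measurable borel" using f by (simp add: in_Lp_def)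
  define g where "g n x = (if 0 < x \<and> x < real n then min \<bar>f x\<bar> (real n) else 0)" for n x
  have [measurable]: "g n \<in> borel_measurable borel" for n
    unfolding g_def[abs_def] by measurable
  have g0: "0 \<le> g n x" for n x by (simp add: g_def)
  have inc: "incseq (\<lambda>n. abs_pos (g n))"
    by (auto simp: incseq_def le_fun_def abs_pos_def g_def indicator_def intro!: ennreal_leI)
  have g_le: "abs_pos (g n) x \<le> abs_pos f x" for n x
    by (auto simp: abs_pos_def g_def indicator_def intro!: ennreal_leI)
  have sup: "(SUP n. abs_pos (g n) x) = abs_pos f x" for x
  proof (rule antisym)
    show "(SUP n. abs_pos (g n) x) \<le> abs_pos f x" by (intro SUP_least g_le)
    obtain n where "max \<bar>f x\<bar> x < real n" using reals_Archimedean2 by blast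
    then have "abs_pos f x = abs_pos (g n) x" by (auto simp: abs_pos_def g_def indicator_def)
    then show "abs_pos f x \<le> (SUP n. abs_pos (g n) x)" by (auto intro: SUP_upper2)
  qed
  have "ennreal c * K s * lpnorm f (1 / s) < lpnorm (Uop \<alpha> \<beta> l f) q"
    using f by (intro times_less_of_less_divide less) (auto simp: in_Lp_def)
  also have "\<dots> \<le> Lnorm (V (abs_pos f)) q"
    using q by (intro lpnorm_Uop_le) auto
  also have "\<dots> = Lnorm (\<lambda>x. SUP n. V (abs_pos (g n)) x) q"
    by (subst V_SUP[OF inc, symmetric]) (auto simp: sup)
  also have "\<dots> = (SUP n. Lnorm (V (abs_pos (g n))) q)"
  proof (rule Lnorm_SUP)
    show "incseq (\<lambda>n. V (abs_pos (g n)))"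
      using inc unfolding incseq_def le_fun_def by (auto intro!: V_mono)
  qed (use q in auto)
  finally obtain n where n: "ennreal c * K s * lpnorm f (1 / s) < Lnorm (V (abs_pos (g n))) q"
    by (auto simp: less_SUP_iff)
  have "ennreal c * K s * Lnorm (abs_pos (g n)) (1 / s) \<le> ennreal c * K s * lpnorm f (1 / s)"
    unfolding lpnorm_eq_Lnorm using q by (intro mult_left_mono Lnorm_mono g_le) auto
  then have "ennreal c * K s * Lnorm (abs_pos (g n)) (1 / s) < Lnorm (V (abs_pos (g n))) q"
    using n by (rule le_less_trans)
  moreover have "g n x \<le> max 1 (real n) * indicator {0<..<max 1 (real n)} x" for x
    by (auto simp: g_def indicator_def)
  ultimately show ?thesis
    using g0 unfolding q_def by (intro exI[of _ "g n"] exI[of _ "max 1 (real n)"]) auto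
qed

text \<open>All three terms of the strict inequality at \<open>s\<close> are log-convex, positive
  and finite, hence continuous; so their difference \<open>D\<close> stays positive near
  \<open>s\<close>.\<close>

lemma near_extremizer_nearby:
  assumes s: "1 - kappa < s" "s < 1 - \<alpha>" and c: "0 \<le> c" "c < 1"
  obtains f M \<eta> where "f \<in> borel_measurable borel" "1 \<le> M" "0 < \<eta>"
    "\<And>x. 0 \<le> f x" "\<And>x. f x \<le> M * indicator {0<..<M} x"
    "\<And>r. 0 < r \<Longrightarrow> r < 1 \<Longrightarrow> 0 < Lnorm (abs_pos f) (1 / r)" "\<And>r. 0 < r \<Longrightarrow> r < 1 \<Longrightarrow> Lnorm (abs_pos f) (1 / r) < top"
    "\<And>r. \<lbrakk>1 - kappa < r; r < 1 - \<alpha>; \<bar>r - s\<bar> < \<eta>\<rbrakk> \<Longrightarrow>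
      ennreal c * K r * Lnorm (abs_pos f) (1 / r) \<le> Lnorm (V (abs_pos f)) (1 / (r + kappa - 1))"
proof -
  obtain f M where [measurable]: "f \<in> borel_measurable borel" and M: "1 \<le> M"
    and f: "\<And>x. 0 \<le> f x" "\<And>x. f x \<le> M * indicator {0<..<M} x"
    and less: "ennreal c * K s * Lnorm (abs_pos f) (1 / s) < Lnorm (V (abs_pos f)) (1 / (s + kappa - 1))"
    using near_extremizer[OF s c] by blast
  define S where "S = {1 - kappa<..<1 - \<alpha>}"
  define N where "N r = Lnorm (abs_pos f) (1 / r)" for r
  define W where "W r = Lnorm (V (abs_pos f)) (1 / (r + kappa - 1))" for r
  have S_pos: "0 < r" "r < 1" if "r \<in> S" for r
    using that kappa_bounds params by (auto simp: S_def)
  have N_fin: "N r < top" if "0 < r" "r < 1" for r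
  proof -
    have "lpnorm f (1 / r) \<le> ennreal (M * M)"
      using f M that by (intro lpnorm_bounded_le) auto
    then show ?thesis unfolding N_def lpnorm_eq_Lnorm by (rule le_less_trans) simp
  qed
  have W_le: "W r \<le> K r * N r" if "r \<in> S" for r
    using that N_fin[OF S_pos[OF that]] unfolding W_def N_def by (intro V_le_K) (auto simp: S_def)
  have W_fin: "W r < top" if "r \<in> S" for r
    by (rule le_less_trans[OF W_le[OF that]])
      (use N_fin[OF S_pos[OF that]] K_less_top[of r] that in \<open>auto simp: S_def ennreal_mult_less_top\<close>)
  have "s \<in> S" using s by (simp add: S_def)
  have "W s \<noteq> 0" using less by (auto simp: W_def)
  \<comment> \<open>A norm is 0 exactly when the function vanishes almost everywhere, whatever the
    exponent; so nonvanishing at \<open>s\<close> passes to every \<open>r\<close>.\<close>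
  then have W_pos: "0 < W r" for r
    by (simp add: W_def Lnorm_eq_0_iff zero_less_iff_neq_zero)
  have "N s \<noteq> 0" using W_le[OF \<open>s \<in> S\<close>] \<open>W s \<noteq> 0\<close> by auto
  then have N_pos: "0 < N r" for r
    by (simp add: N_def Lnorm_eq_0_iff zero_less_iff_neq_zero)
  have S: "open S" "convex S" by (auto simp: S_def)
  have cK: "continuous_on S (\<lambda>r. enn2real (K r))"
    by (rule logconvex_imp_continuous_on[OF S]) (simp_all add: S_def K_pos K_less_top K_logconvex)
  have cN: "continuous_on S (\<lambda>r. enn2real (N r))"
  proof (rule logconvex_imp_continuous_on[OF S])
    fix s0 s1 t assume "s0 \<in> S" "s1 \<in> S" "0 < t" "t < (1::real)"
    then show "N ((1 - t) * s0 + t * s1) \<le> ennreal_powr (N s0) (1 - t) * ennreal_powr (N s1) t"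
      unfolding N_def using S_pos by (intro Lnorm_logconvex) auto
  qed (simp_all add: N_pos N_fin S_pos)
  have cW: "continuous_on S (\<lambda>r. enn2real (W r))"
  proof (rule logconvex_imp_continuous_on[OF S])
    fix s0 s1 t assume "s0 \<in> S" "s1 \<in> S" and t: "0 < t" "t < (1::real)"
    then have "0 < s0 + kappa - 1" "0 < s1 + kappa - 1" by (simp_all add: S_def)
    then show "W ((1 - t) * s0 + t * s1) \<le> ennreal_powr (W s0) (1 - t) * ennreal_powr (W s1) t"
      unfolding W_def by (intro Lnorm_logconvex t) (simp_all, simp add: algebra_simps)
  qed (simp_all add: W_pos W_fin)
  define D where "D r = enn2real (W r) - c * enn2real (K r) * enn2real (N r)" for r
  have D: "continuous_on S D"
    unfolding D_def by (intro continuous_intros cK cN cW)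
  have K_fin: "0 < K r" "K r < top" if "r \<in> S" for r
    using that by (auto simp: S_def intro: K_pos K_less_top)
  have real: "W r = ennreal (enn2real (W r))" 
    "ennreal c * K r * N r = ennreal (c * enn2real (K r) * enn2real (N r))" if "r \<in> S" for r
    using W_fin[OF that] N_fin[OF S_pos[OF that]] K_fin[OF that] c by (simp_all add: ennreal_mult)
  have "ennreal (c * enn2real (K s) * enn2real (N s)) < ennreal (enn2real (W s))"
    using less real[OF \<open>s \<in> S\<close>] by (simp add: W_def N_def)
  then have "c * enn2real (K s) * enn2real (N s) < enn2real (W s)"
    using c by (simp add: ennreal_less_iff del: ennreal_enn2real_if)
  then have "0 < D s" by (simp add: D_def)
  obtain \<eta> where \<eta>: "0 < \<eta>" "\<And>r. r \<in> S \<Longrightarrow> dist r s < \<eta> \<Longrightarrow> dist (D r) (D s) < D s"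
    using D[unfolded continuous_on_iff, rule_format, OF \<open>s \<in> S\<close> \<open>0 < D s\<close>] by blast
  show ?thesis
  proof (rule that[of f M \<eta>])
    fix r assume r: "1 - kappa < r" "r < 1 - \<alpha>" "\<bar>r - s\<bar> < \<eta>"
    then have "r \<in> S" "dist (D r) (D s) < D s"
      using \<eta>(2)[of r] by (auto simp: S_def dist_real_def)
    then have "0 < D r" by (auto simp: dist_real_def)
    have "ennreal c * K r * N r = ennreal (c * enn2real (K r) * enn2real (N r))"
      by (rule real(2)[OF \<open>r \<in> S\<close>])
    also have "\<dots> \<le> ennreal (enn2real (W r))"
      using \<open>0 < D r\<close> unfolding D_def by (intro ennreal_leI) auto
    also have "\<dots> = W r"
      by (rule real(1)[OF \<open>r \<in> S\<close>, symmetric])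
    finally show "ennreal c * K r * Lnorm (abs_pos f) (1 / r) \<le> Lnorm (V (abs_pos f)) (1 / (r + kappa - 1))"
      by (simp only: W_def N_def)
  next
    show "f \<in> borel_measurable borel" by measurable
    show "1 \<le> M" by (fact M)
    show "0 < \<eta>" by (fact \<eta>)
    show "0 \<le> f x" "f x \<le> M * indicator {0<..<M} x" for x by (fact f)+
    show "0 < Lnorm (abs_pos f) (1 / r)" for r using N_pos by (simp add: N_def)
    show "Lnorm (abs_pos f) (1 / r) < top" if "0 < r" "r < 1" for r using N_fin[OF that] by (simp add: N_def)
  qed
qed

lemma abs_pos_dilate: "0 < d \<Longrightarrow> abs_pos (\<lambda>x. f (d * x)) = (\<lambda>x. abs_pos f (d * x))"
  by (auto simp: abs_pos_def fun_eq_iff indicator_def zero_less_mult_iff)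

text \<open>The factor \<open>d powr (kappa - 1)\<close> of the operator and the factor of the
  target norm combine to \<open>d powr (- s)\<close>, exactly the factor by which the L_(1/s) norm
  of \<open>g\<close> changes. Near-extremality therefore survives dilation at every exponent
  simultaneously.\<close>

lemma Lnorm_V_dilate:
  assumes [measurable]: "g \<in> borel_measurable borel" and d: "0 < d" and s: "1 - kappa < s"
  shows "Lnorm (V (\<lambda>x. g (d * x))) (1 / (s + kappa - 1))
    = ennreal (d powr (- s)) * Lnorm (V g) (1 / (s + kappa - 1))"
proof -
  have V: "V (\<lambda>y. g (d * y)) = (\<lambda>x. ennreal (d powr (kappa - 1)) * V g (d * x))"
    by (rule ext) (rule V_dilate[OF assms(1) d])
  define q where "q = 1 / (s + kappa - 1)"
  have q: "0 < q" "- 1 / q = - (s + kappa - 1)" using s by (simp_all add: q_def)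
  have "Lnorm (V (\<lambda>x. g (d * x))) q = ennreal (d powr (kappa - 1)) * Lnorm (\<lambda>x. V g (d * x)) q"
    unfolding V by (rule Lnorm_cmult[OF _ q(1)]) measurable
  also have "Lnorm (\<lambda>x. V g (d * x)) q = ennreal (d powr (- (s + kappa - 1))) * Lnorm (V g) q"
    using Lnorm_dilate[OF measurable_V[OF assms(1)] d q(1)] by (simp only: q(2))
  also have "ennreal (d powr (kappa - 1)) * (ennreal (d powr (- (s + kappa - 1))) * Lnorm (V g) q)
      = ennreal (d powr (kappa - 1) * d powr (- (s + kappa - 1))) * Lnorm (V g) q"
    by (simp add: ennreal_mult mult.assoc)
  also have "d powr (kappa - 1) * d powr (- (s + kappa - 1)) = d powr (- s)"
    by (subst powr_add[symmetric]) simp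
  finally show ?thesis unfolding q_def .
qed

end

section \<open>Grand Lebesgue norms\<close>

lemma gls_norm_image: "gls_norm w (h ` P) f = (SUP p \<in> P. lpnorm f (h p) / w (h p))"
  by (simp add: gls_norm_def image_image)

context potential
begin

lemma pexp_qexp: "pexp \<alpha> \<beta> l (qexp \<alpha> \<beta> l p) = p"
  by (simp add: pexp_def qexp_def)

lemma qexp_eq: "qexp \<alpha> \<beta> l p = 1 / (1 / p + kappa - 1)"
  by (simp add: qexp_def kappa_def add.assoc)

text \<open>The finite norm over \<open>T\<close> puts \<open>f\<close> into L_p for each
  \<open>p\<close> in \<open>P\<close>; there the bound by \<open>K\<close> applies, and dividing by
  both weights compares the suprema term by term.\<close>

lemma gls_norm_Uop_le:
  assumes "P \<subseteq> T" and P: "\<And>p. p \<in> P \<Longrightarrow> 1 - kappa < 1 / p \<and> 1 / p < 1 - \<alpha> \<and> 0 < \<psi> p"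
    and [measurable]: "f \<in> borel_measurable borel" and fin: "gls_norm (\<lambda>p. ennreal (\<psi> p)) T f < top"
  shows "(SUP p\<in>P. lpnorm (Uop \<alpha> \<beta> l f) (qexp \<alpha> \<beta> l p) / (K (1 / p) * ennreal (\<psi> p)))
    \<le> gls_norm (\<lambda>p. ennreal (\<psi> p)) P f"
  unfolding gls_norm_def
proof (rule SUP_mono)
  fix p assume p: "p \<in> P"
  have s: "1 - kappa < 1 / p" "1 / p < 1 - \<alpha>" "0 < \<psi> p" using P[OF p] by auto
  have "lpnorm f p / ennreal (\<psi> p) \<le> gls_norm (\<lambda>p. ennreal (\<psi> p)) T f"
    unfolding gls_norm_def using p \<open>P \<subseteq> T\<close> by (intro SUP_upper) auto
  then have "lpnorm f p / ennreal (\<psi> p) < top" using fin by (rule le_less_trans)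
  then have "lpnorm f p < top"
    using s by (cases "lpnorm f p") (auto simp: ennreal_top_divide)
  then have "lpnorm (Uop \<alpha> \<beta> l f) (qexp \<alpha> \<beta> l p) \<le> K (1 / p) * lpnorm f p"
    using lpnorm_Uop_le_K[OF s(1,2), of f] by (simp add: qexp_eq)
  then have "lpnorm (Uop \<alpha> \<beta> l f) (qexp \<alpha> \<beta> l p) / (K (1 / p) * ennreal (\<psi> p))
      \<le> lpnorm f p / ennreal (\<psi> p)"
    using s K_pos[OF s(1,2)]
    by (intro divide_le_posI_ennreal) (auto simp: cancel_weight ennreal_zero_less_mult_iff)
  then show "\<exists>m\<in>P. lpnorm (Uop \<alpha> \<beta> l f) (qexp \<alpha> \<beta> l p) / (K (1 / p) * ennreal (\<psi> p))
      \<le> lpnorm f m / ennreal (\<psi> m)" using p by blast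
qed

text \<open>Every term of the left supremum is dominated by a term on the right: for
  \<open>p\<close> close to \<open>Sup P\<close> by the one with the same \<open>p\<close>, and
  otherwise, after a strong dilation, by the one at a fixed point \<open>p1\<close> close to
  \<open>Sup P\<close>.\<close>

lemma gls_norm_Uop_sharp:
  assumes T: "\<And>p. p \<in> T \<Longrightarrow> 1 \<le> p \<and> \<epsilon> \<le> \<psi> p" "0 < \<epsilon>" and P: "P \<subseteq> T" "P \<noteq> {}" "bdd_above P"
    and s: "\<And>p. p \<in> P \<Longrightarrow> 1 - kappa < 1 / p \<and> 1 / p < 1 - \<alpha>" "1 - kappa < 1 / Sup P"
    and c: "0 \<le> c" "c < 1"
  obtains f where "f \<in> borel_measurable borel" "gls_norm (\<lambda>p. ennreal (\<psi> p)) T f < top"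
    "0 < gls_norm (\<lambda>p. ennreal (\<psi> p)) P f"
    "ennreal c * gls_norm (\<lambda>p. ennreal (\<psi> p)) P f
      \<le> (SUP p\<in>P. lpnorm (Uop \<alpha> \<beta> l f) (qexp \<alpha> \<beta> l p) / (K (1 / p) * ennreal (\<psi> p)))"
proof -
  \<comment> \<open>This need not be \<open>1 / p\<close> for some \<open>p\<close> in
    \<open>P\<close>, but \<open>K\<close> is finite and continuous around it since it lies above
    \<open>1 - kappa\<close>.\<close>
  define sb where "sb = 1 / Sup P"
  have P_ge: "1 \<le> p" "0 < \<psi> p" "0 < p" if "p \<in> P" for p
    using T(1)[of p] T(2) P(1) that by auto
  have sb_le: "sb \<le> 1 / p" if "p \<in> P" for p
    using cSup_upper[OF that P(3)] P_ge[OF that] by (simp add: sb_def frac_le)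
  have "sb < 1 - \<alpha>" using sb_le s(1) P(2) by fastforce
  moreover have "1 - kappa < sb" using s(2) by (simp add: sb_def)
  ultimately obtain f M \<eta> where [measurable]: "f \<in> borel_measurable borel" and M: "1 \<le> M" and \<eta>: "0 < \<eta>"
    and f0: "\<And>x. 0 \<le> f x" and fM: "\<And>x. f x \<le> M * indicator {0<..<M} x"
    and Lnorm_f: "\<And>r. 0 < r \<Longrightarrow> r < 1 \<Longrightarrow> 0 < Lnorm (abs_pos f) (1 / r)"
      "\<And>r. 0 < r \<Longrightarrow> r < 1 \<Longrightarrow> Lnorm (abs_pos f) (1 / r) < top"
    and ext: "\<And>r. \<lbrakk>1 - kappa < r; r < 1 - \<alpha>; \<bar>r - sb\<bar> < \<eta>\<rbrakk> \<Longrightarrow>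
      ennreal c * K r * Lnorm (abs_pos f) (1 / r) \<le> Lnorm (V (abs_pos f)) (1 / (r + kappa - 1))"
    using near_extremizer_nearby[of sb c] c by blast
  have P_s: "0 < 1 / p" "1 / p < 1" if "p \<in> P" for p
  proof -
    show "0 < 1 / p" using P_ge(3)[OF that] by simp
    have "1 / p < 1 - \<alpha>" using s(1)[OF that] by simp
    also have "\<dots> < 1" using params by simp
    finally show "1 / p < 1" .
  qed
  have f_fin: "gls_norm (\<lambda>p. ennreal (\<psi> p)) T h < top"
    if "h \<in> borel_measurable borel" "\<And>x. 0 \<le> h x" "\<And>x. h x \<le> M * indicator {0<..<M} x" for h
  proof -
    have "gls_norm (\<lambda>p. ennreal (\<psi> p)) T h \<le> ennreal (M * M) / ennreal \<epsilon>"
      unfolding gls_norm_def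
    proof (rule SUP_least)
      fix p assume "p \<in> T"
      then have p: "1 \<le> p" "\<epsilon> \<le> \<psi> p" using T(1) by auto
      have "lpnorm h p / ennreal (\<psi> p) \<le> ennreal (M * M) / ennreal (\<psi> p)"
        using that M p by (intro divide_right_mono_ennreal lpnorm_bounded_le)
      also have "\<dots> \<le> ennreal (M * M) / ennreal \<epsilon>"
        using p T(2) M by (simp add: divide_ennreal ennreal_leI frac_le)
      finally show "lpnorm h p / ennreal (\<psi> p) \<le> ennreal (M * M) / ennreal \<epsilon>" .
    qed
    also have "\<dots> < top" using T(2) M by (simp add: divide_ennreal)
    finally show ?thesis .
  qed
  have sub: "gls_norm w P h \<le> gls_norm w T h" for w h
    unfolding gls_norm_def using P by (intro SUP_subset_mono) auto
  have "0 < Sup P" using P P_ge cSup_upper by (metis ex_in_conv less_le_trans)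
  then have "0 < sb" by (simp add: sb_def)
  then have "1 / (sb + \<eta>) < 1 / sb"
    using \<eta> by (intro divide_strict_left_mono) auto
  also have "1 / sb = Sup P" by (simp add: sb_def)
  finally have "1 / (sb + \<eta>) < Sup P" .
  then obtain p1 where p1: "p1 \<in> P" "1 / (sb + \<eta>) < p1"
    using P by (auto simp: less_cSup_iff)
  \<comment> \<open>The gain: dilation by \<open>d\<close> gives \<open>p1\<close> an advantage of
    at least \<open>d powr \<tau>\<close> over all \<open>p\<close> with \<open>1 / p\<close> at
    least \<open>sb + \<eta>\<close>.\<close>
  define \<tau> where "\<tau> = sb + \<eta> - 1 / p1"
  have \<tau>: "0 < \<tau>"
    using p1 P_ge[OF p1(1)] \<eta> \<open>0 < sb\<close> by (simp add: \<tau>_def field_simps)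
  define m where "m p = enn2real (lpnorm f p / ennreal (\<psi> p))" for p
  define G where "G = enn2real (gls_norm (\<lambda>p. ennreal (\<psi> p)) P f)"
  have G: "gls_norm (\<lambda>p. ennreal (\<psi> p)) P f = ennreal G"
    using sub[of "\<lambda>p. ennreal (\<psi> p)" f] f_fin[of f] f0 fM by (auto simp: G_def intro: le_less_trans)
  have lp: "0 < lpnorm f p" "lpnorm f p < top" if "p \<in> P" for p
    using Lnorm_f[OF P_s[OF that]] by (auto simp: lpnorm_eq_Lnorm)
  have m: "lpnorm f p / ennreal (\<psi> p) = ennreal (m p)" "0 < m p" if "p \<in> P" for p
  proof -
    have "lpnorm f p / ennreal (\<psi> p) < top" "0 < lpnorm f p / ennreal (\<psi> p)"
      using lp[OF that] P_ge[OF that]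
      by (auto simp: ennreal_zero_less_divide ennreal_divide_eq_top_iff simp flip: less_top)
    then show "lpnorm f p / ennreal (\<psi> p) = ennreal (m p)" "0 < m p"
      by (auto simp: m_def enn2real_positive_iff)
  qed
  have m_le: "m p \<le> G" if "p \<in> P" for p
  proof -
    have "ennreal (m p) \<le> ennreal G"
      unfolding G[symmetric] m(1)[OF that, symmetric] gls_norm_def using that by (intro SUP_upper) auto
    then show ?thesis by (subst (asm) ennreal_le_iff) (auto simp: G_def)
  qed
  \<comment> \<open>Chosen so that \<open>d powr \<tau>\<close> is at least \<open>G / m p1\<close>:
    the advantage then outweighs the largest ratio by which another weighted norm can exceed the one
    at \<open>p1\<close>.\<close>
  define d where "d = max 1 (G / m p1) powr (1 / \<tau>)"
  have d: "1 \<le> d" using \<tau> by (simp add: d_def ge_one_powr_ge_zero)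
  have "G / m p1 \<le> d powr \<tau>"
    using \<tau> by (simp add: d_def powr_powr)
  then have G_le: "d powr (- (sb + \<eta>)) * G \<le> d powr (- 1 / p1) * m p1"
    using m(2)[OF p1(1)] d by (simp add: \<tau>_def powr_diff powr_minus powr_add field_simps)
  define h where "h x = f (d * x)" for x
  have h_eq: "h = (\<lambda>x. f (d * x))" by (simp add: h_def fun_eq_iff)
  have [measurable]: "h \<in> borel_measurable borel" unfolding h_eq by measurable
  have h0: "0 \<le> h x" for x using f0 by (simp add: h_def)
  \<comment> \<open>As \<open>d\<close> is at least 1, the dilation shrinks the support towards 0,
    so the bound for \<open>f\<close> persists and \<open>f_fin\<close> applies to
    \<open>h\<close>.\<close>
  have hM: "h x \<le> M * indicator {0<..<M} x" for x
  proof -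
    have "indicator {0<..<M} (d * x) \<le> (indicator {0<..<M} x :: real)"
    proof (cases "0 < x")
      case True
      then have "1 * x \<le> d * x" using d by (intro mult_right_mono) auto
      then have "d * x < M \<longrightarrow> x < M" by linarith
      then show ?thesis using True d by (auto simp: indicator_def)
    next
      case False
      then show ?thesis using d by (auto simp: indicator_def zero_less_mult_iff)
    qed
    then have "M * indicator {0<..<M} (d * x) \<le> M * indicator {0<..<M} x"
      using M by (intro mult_left_mono) auto
    then show ?thesis using fM[of "d * x"] by (simp add: h_def)
  qed
  have pos_h: "abs_pos h = (\<lambda>x. abs_pos f (d * x))"
    unfolding h_eq using d by (intro abs_pos_dilate) auto
  have lp_h: "lpnorm h p = ennreal (d powr (- 1 / p)) * lpnorm f p" if "p \<in> P" for p
    unfolding lpnorm_eq_Lnorm pos_h using d P_ge[OF that] by (intro Lnorm_dilate) auto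
  have m_h: "lpnorm h p / ennreal (\<psi> p) = ennreal (d powr (- 1 / p) * m p)" if "p \<in> P" for p
    unfolding lp_h[OF that] using m[OF that] by (simp add: ennreal_mult flip: ennreal_times_divide)
  have near: "ennreal c * (lpnorm h p / ennreal (\<psi> p))
      \<le> lpnorm (Uop \<alpha> \<beta> l h) (qexp \<alpha> \<beta> l p) / (K (1 / p) * ennreal (\<psi> p))"
    if p: "p \<in> P" and "1 / p < sb + \<eta>" for p
  proof -
    define q where "q = 1 / (1 / p + kappa - 1)"
    have sp: "1 - kappa < 1 / p" "1 / p < 1 - \<alpha>" using s(1)[OF p] by auto
    have "ennreal c * K (1 / p) * Lnorm (abs_pos f) p \<le> Lnorm (V (abs_pos f)) q"
      using ext[OF sp] that sb_le[OF p] by (simp add: q_def)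
    then have "ennreal (d powr (- 1 / p)) * (ennreal c * K (1 / p) * Lnorm (abs_pos f) p)
        \<le> ennreal (d powr (- 1 / p)) * Lnorm (V (abs_pos f)) q"
      by (intro mult_left_mono) auto
    also have "\<dots> = Lnorm (V (abs_pos h)) q"
      using Lnorm_V_dilate[of "abs_pos f" d "1 / p"] d sp unfolding pos_h q_def by simp
    also have "\<dots> = lpnorm (Uop \<alpha> \<beta> l h) (qexp \<alpha> \<beta> l p)"
    proof -
      have "Lnorm (abs_pos h) p < top"
        using lp[OF p] by (simp add: lp_h[OF p] ennreal_mult_less_top flip: lpnorm_eq_Lnorm)
      then have "Lnorm (V (abs_pos h)) q \<le> K (1 / p) * Lnorm (abs_pos h) p" "K (1 / p) * Lnorm (abs_pos h) p < top"
        using V_le_K[OF sp, of "abs_pos h"] K_less_top[OF sp] by (auto simp: q_def ennreal_mult_less_top)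
      then show ?thesis
        using h0 unfolding qexp_eq q_def[symmetric] by (subst lpnorm_Uop_eq) (auto intro: le_less_trans)
    qed
    finally have le: "ennreal c * (K (1 / p) * lpnorm h p) \<le> lpnorm (Uop \<alpha> \<beta> l h) (qexp \<alpha> \<beta> l p)"
      unfolding lp_h[OF p] unfolding lpnorm_eq_Lnorm by (simp add: mult_ac)
    have w: "0 < K (1 / p) * ennreal (\<psi> p)" "K (1 / p) * ennreal (\<psi> p) < top"
      using K_pos[OF sp] K_less_top[OF sp] P_ge[OF p]
      by (auto simp: ennreal_zero_less_mult_iff ennreal_mult_less_top)
    have "ennreal c * (lpnorm h p / ennreal (\<psi> p))
        = ennreal c * (lpnorm h p / ennreal (\<psi> p)) * (K (1 / p) * ennreal (\<psi> p))
          / (K (1 / p) * ennreal (\<psi> p))"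
      using w by (subst ennreal_mult_divide_eq) auto
    also have "ennreal c * (lpnorm h p / ennreal (\<psi> p)) * (K (1 / p) * ennreal (\<psi> p))
        = ennreal c * (K (1 / p) * lpnorm h p)"
      unfolding mult.assoc mult.commute[of "lpnorm h p / ennreal (\<psi> p)"]
      using P_ge[OF p] by (subst mult.assoc[symmetric]) (simp add: cancel_weight)
    also have "\<dots> / (K (1 / p) * ennreal (\<psi> p))
        \<le> lpnorm (Uop \<alpha> \<beta> l h) (qexp \<alpha> \<beta> l p) / (K (1 / p) * ennreal (\<psi> p))"
      using le by (rule divide_right_mono_ennreal)
    finally show ?thesis .
  qed
  show ?thesis
  proof
    show "h \<in> borel_measurable borel" by measurable
    show "gls_norm (\<lambda>p. ennreal (\<psi> p)) T h < top"
      using h0 hM by (intro f_fin) auto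
    have "0 < lpnorm h p1 / ennreal (\<psi> p1)"
      unfolding m_h[OF p1(1)] using m(2)[OF p1(1)] d by auto
    also have "\<dots> \<le> gls_norm (\<lambda>p. ennreal (\<psi> p)) P h"
      unfolding gls_norm_def using p1 by (intro SUP_upper) auto
    finally show "0 < gls_norm (\<lambda>p. ennreal (\<psi> p)) P h" .
    have "ennreal c * gls_norm (\<lambda>p. ennreal (\<psi> p)) P h = (SUP p\<in>P. ennreal c * (lpnorm h p / ennreal (\<psi> p)))"
      unfolding gls_norm_def by (rule SUP_mult_left_ennreal)
    also have "\<dots> \<le> (SUP p\<in>P. lpnorm (Uop \<alpha> \<beta> l h) (qexp \<alpha> \<beta> l p) / (K (1 / p) * ennreal (\<psi> p)))"
    proof (rule SUP_mono)
      fix p assume p: "p \<in> P"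
      show "\<exists>p'\<in>P. ennreal c * (lpnorm h p / ennreal (\<psi> p))
        \<le> lpnorm (Uop \<alpha> \<beta> l h) (qexp \<alpha> \<beta> l p') / (K (1 / p') * ennreal (\<psi> p'))"
      proof (cases "1 / p < sb + \<eta>")
        case True
        then show ?thesis using near p by blast
      next
        case False
        \<comment> \<open>Far from \<open>Sup P\<close> the dilation factor is at most
          \<open>d powr (- (sb + \<eta>))\<close> and the weighted norm of \<open>f\<close> at most
          \<open>G\<close>; by \<open>G_le\<close> their product is below the term at
          \<open>p1\<close>.\<close>
        have "d powr (- 1 / p) * m p \<le> d powr (- (sb + \<eta>)) * G"
          using False d m_le[OF p] m(2)[OF p] by (intro mult_mono powr_mono) auto
        also note G_le
        finally have "lpnorm h p / ennreal (\<psi> p) \<le> lpnorm h p1 / ennreal (\<psi> p1)"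
          unfolding m_h[OF p] m_h[OF p1(1)] by (rule ennreal_leI)
        then have "ennreal c * (lpnorm h p / ennreal (\<psi> p)) \<le> ennreal c * (lpnorm h p1 / ennreal (\<psi> p1))"
          by (intro mult_left_mono) auto
        also have "\<dots> \<le> lpnorm (Uop \<alpha> \<beta> l h) (qexp \<alpha> \<beta> l p1) / (K (1 / p1) * ennreal (\<psi> p1))"
          using \<tau> p1 by (intro near) (auto simp: \<tau>_def)
        finally show ?thesis using p1 by blast
      qed
    qed
    finally show "ennreal c * gls_norm (\<lambda>p. ennreal (\<psi> p)) P h
      \<le> (SUP p\<in>P. lpnorm (Uop \<alpha> \<beta> l h) (qexp \<alpha> \<beta> l p) / (K (1 / p) * ennreal (\<psi> p)))" .
  qed
qed

end

theorem theorem4p1: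
  fixes \<alpha> \<beta> lam A :: real and B :: ereal and \<psi> :: "real \<Rightarrow> real"
  assumes "0 < \<alpha>" "\<alpha> < 1" "0 < \<beta>" "\<beta> < 1" "0 < lam" "lam < 1"
    and "\<alpha> + \<beta> + lam < 1"
    and "1 \<le> A" "ereal A < B"
    and "PsiAB A B \<psi>"
  defines "pm \<equiv> 1 / (1 - \<alpha>)" and "pp \<equiv> 1 / (1 - \<alpha> - lam)"
  defines "P \<equiv> {p. A < p \<and> ereal p < B \<and> pm < p \<and> p < pp}"
  defines "\<psi>K \<equiv> (\<lambda>q. Kconst \<alpha> \<beta> lam (pexp \<alpha> \<beta> lam q) * ennreal (\<psi> (pexp \<alpha> \<beta> lam q)))"
  defines "Q \<equiv> qexp \<alpha> \<beta> lam ` P"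
  defines "GA \<equiv> {f. f \<in> borel_measurable lborel \<and>
                    gls_norm (\<lambda>p. ennreal (\<psi> p)) {p. A < p \<and> ereal p < B} f < \<infinity>}"
  assumes "P \<noteq> {}"
  shows "(\<forall>f \<in> GA. gls_norm \<psi>K Q (Uop \<alpha> \<beta> lam f)
                    \<le> 1 * gls_norm (\<lambda>p. ennreal (\<psi> p)) P f)
         \<and> (\<forall>c::ennreal. c < 1 \<longrightarrow>
              (\<exists>f \<in> GA. gls_norm \<psi>K Q (Uop \<alpha> \<beta> lam f)
                          > c * gls_norm (\<lambda>p. ennreal (\<psi> p)) P f))"
proof -
  interpret potential \<alpha> \<beta> lam
    using assms(1-7) by unfold_locales auto
  define T where "T = {p. A < p \<and> ereal p < B}"
  have PT: "P \<subseteq> T" by (auto simp: P_def T_def)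
  obtain \<epsilon> where \<epsilon>: "0 < \<epsilon>" "\<And>p. p \<in> T \<Longrightarrow> 1 \<le> p \<and> \<epsilon> \<le> \<psi> p"
    using \<open>PsiAB A B \<psi>\<close> \<open>1 \<le> A\<close> by (fastforce simp: PsiAB_def T_def)
  have nz: "0 < 1 - \<alpha>" "0 < 1 - \<alpha> - lam" using assms(1-7) by auto
  have Ps: "1 - kappa < 1 / p \<and> 1 / p < 1 - \<alpha> \<and> 0 < \<psi> p" if "p \<in> P" for p
  proof -
    have "0 < p" "0 < \<psi> p" using \<epsilon>(2)[of p] \<epsilon>(1) PT that by auto
    moreover have "1 < p * (1 - \<alpha>)" "p * (1 - \<alpha> - lam) < 1"
      using that nz by (auto simp: P_def pm_def pp_def pos_divide_less_eq pos_less_divide_eq)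
    ultimately have "1 - \<alpha> - lam < 1 / p" "1 / p < 1 - \<alpha>"
      by (auto simp: pos_divide_less_eq pos_less_divide_eq mult.commute)
    then show ?thesis using \<open>0 < \<psi> p\<close> \<open>0 < \<beta>\<close> by (auto simp: kappa_def)
  qed
  have bdd: "bdd_above P" by (auto simp: P_def intro!: bdd_aboveI[of _ pp])
  \<comment> \<open>\<open>Sup P\<close> may equal \<open>pp\<close>, but \<open>1 / pp\<close>
    exceeds \<open>1 - kappa\<close> by \<beta>, which is positive.\<close>
  have Sup: "1 - kappa < 1 / Sup P"
  proof -
    obtain p where "p \<in> P" using \<open>P \<noteq> {}\<close> by auto
    then have "0 < Sup P"
      using cSup_upper[OF _ bdd, of p] \<epsilon>(2)[of p] PT by auto
    moreover have "Sup P \<le> pp"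
      using \<open>P \<noteq> {}\<close> by (intro cSup_least) (auto simp: P_def)
    ultimately have "1 - \<alpha> - lam \<le> 1 / Sup P"
      using nz by (simp add: pp_def field_simps)
    then show ?thesis using \<open>0 < \<beta>\<close> by (simp add: kappa_def)
  qed
  \<comment> \<open>Reindexes the supremum over \<open>q\<close> by \<open>p\<close>, since
    \<open>pexp\<close> undoes \<open>qexp\<close>.\<close>
  have gls_Q: "gls_norm \<psi>K Q g
      = (SUP p\<in>P. lpnorm g (qexp \<alpha> \<beta> lam p) / (K (1 / p) * ennreal (\<psi> p)))" for g
    by (simp add: Q_def gls_norm_image \<psi>K_def pexp_qexp K_def)
  have GA: "f \<in> GA \<longleftrightarrow> f \<in> borel_measurable borel \<and> gls_norm (\<lambda>p. ennreal (\<psi> p)) T f < top" for f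
    by (simp add: GA_def T_def)
  show ?thesis
  proof (intro conjI ballI allI impI)
    fix f assume "f \<in> GA"
    then show "gls_norm \<psi>K Q (Uop \<alpha> \<beta> lam f) \<le> 1 * gls_norm (\<lambda>p. ennreal (\<psi> p)) P f"
      unfolding gls_Q using PT Ps by (simp add: GA gls_norm_Uop_le[where T=T])
  next
    fix c :: ennreal assume "c < 1"
    \<comment> \<open>The constant in between turns the weak inequality for \<open>c'\<close> into a
      strict one for \<open>c\<close>, as the norm over \<open>P\<close> is positive and
      finite.\<close>
    then obtain c' where c': "c < c'" "c' < 1" using dense by blast
    then obtain r where r: "c' = ennreal r" "0 \<le> r" by (cases c') auto
    have "r < 1" using c' r by (simp add: ennreal_less_one_iff)
    obtain f where f: "f \<in> borel_measurable borel" "gls_norm (\<lambda>p. ennreal (\<psi> p)) T f < top"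
      "0 < gls_norm (\<lambda>p. ennreal (\<psi> p)) P f"
      "ennreal r * gls_norm (\<lambda>p. ennreal (\<psi> p)) P f \<le> gls_norm \<psi>K Q (Uop \<alpha> \<beta> lam f)"
      unfolding gls_Q
      using gls_norm_Uop_sharp[OF \<epsilon>(2,1) PT \<open>P \<noteq> {}\<close> bdd _ Sup \<open>0 \<le> r\<close> \<open>r < 1\<close>] Ps by blast
    have "gls_norm (\<lambda>p. ennreal (\<psi> p)) P f \<le> gls_norm (\<lambda>p. ennreal (\<psi> p)) T f"
      unfolding gls_norm_def using PT by (intro SUP_subset_mono) auto
    then have "c * gls_norm (\<lambda>p. ennreal (\<psi> p)) P f < ennreal r * gls_norm (\<lambda>p. ennreal (\<psi> p)) P f"
      using f c' r by (intro ennreal_mult_strict_right_mono) (auto intro: le_less_trans)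
    then show "\<exists>f\<in>GA. c * gls_norm (\<lambda>p. ennreal (\<psi> p)) P f < gls_norm \<psi>K Q (Uop \<alpha> \<beta> lam f)"
      using f by (auto simp: GA intro!: bexI[of _ f] intro: less_le_trans)
  qed
qed

end
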